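(* Let $n\ge 5$ be an integer, let $a\ge 0$ and let $p>\frac{n+4+2a}{n-4}$. Assume that $0\le a\le \inf_{k\ge 0}A_k$, where the numbers $A_k=A_k(n,p)$ are defined in the context. Let $u$ be a bounded positive solution of $\Delta^2 u=|x|^a u^p$ in $\mathbb{R}^n$. Then the scalar curvature $S_g$ of the conformal metric $g=u^{\frac{4}{n-4}}g_0$ on $\mathbb{R}^n$, where $g_0$ is the Euclidean metric, that is $$S_g=-\frac{4(n-1)}{n-2}\,u^{-\frac{n+2}{n-4}}\,\Delta\!\left(u^{\frac{n-2}{n-4}}\right),$$ is positive in $\mathbb{R}^n$.
   Context: Solutions are classical ($u\in C^4(\mathbb{R}^n)$). Define sequences $(\alpha_k)_{k\ge0}$, $(\beta_k)_{k\ge0}$ by $\alpha_0=0$, $\beta_0=\sqrt{\frac{2}{p+1}}$ and $$\alpha_{k+1}=\frac{4(\alpha_k+1)-n+\sqrt{n(16\alpha_k^2+24\alpha_k+n+8)}}{4(n-1)},\qquad \beta_{k+1}=\sqrt{\frac{2}{p+1}+\frac{4}{(p+1)n}\alpha_k\beta_k^2}.$$ For $k\ge 0$ put $$I^{(3)}_{0,\alpha_k,\beta_k}:=\frac4n\alpha_{k+1}\beta_k(\alpha_{k+1}+\alpha_k+1)+\beta_{k+1}\alpha_{k+1}-(p+1)\beta_{k+1}\alpha_{k+1}+\frac{p+1}{2}\Big(\frac{p-1}{2}-\alpha_{k+1}\Big)\beta_{k+1}$$ and $$A_k:=\frac{2(n-2)\,I^{(3)}_{0,\alpha_k,\beta_k}}{\beta_{k+1}\big(\frac{p+1}{2}-\alpha_{k+1}\big)^2-I^{(3)}_{0,\alpha_k,\beta_k}}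 .$$ *)

theory Defs
  imports "HOL-Analysis.Analysis"
begin

definition partial_deriv :: "'n::finite \<Rightarrow> (real ^ 'n \<Rightarrow> real) \<Rightarrow> real ^ 'n \<Rightarrow> real" where
  "partial_deriv i f x = frechet_derivative f (at x) (axis i 1)"

primrec C_k :: "nat \<Rightarrow> (real ^ 'n::finite \<Rightarrow> real) \<Rightarrow> bool" where
  "C_k 0 f \<longleftrightarrow> continuous_on UNIV f"
| "C_k (Suc k) f \<longleftrightarrow> (\<forall>x. f differentiable (at x)) \<and> (\<forall>i. C_k k (partial_deriv i f))"

definition laplacian :: "(real ^ 'n::finite \<Rightarrow> real) \<Rightarrow> real ^ 'n \<Rightarrow> real" where
  "laplacian f x = (\<Sum>i\<in>UNIV. partial_deriv i (partial_deriv i f) x)"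

(* The weight |x|^a for a >= 0. The case distinction is needed because 0 powr 0 = 0,
   whereas |x|^0 is the constant 1, also at the origin. *)
definition norm_pow :: "real ^ 'n::finite \<Rightarrow> real \<Rightarrow> real" where
  "norm_pow x a = (if a = 0 then 1 else norm x powr a)"

(* Classical: u is of class C^4, and the equation holds at every point. *)
definition bounded_positive_solution ::
  "real \<Rightarrow> real \<Rightarrow> (real ^ 'n::finite \<Rightarrow> real) \<Rightarrow> bool" where
  "bounded_positive_solution a p u \<longleftrightarrow>
     C_k 4 u \<and> bounded (range u) \<and> (\<forall>x. u x > 0) \<and>
     (\<forall>x. laplacian (laplacian u) x = norm_pow x a * u x powr p)"

primrec alpha_seq :: "nat \<Rightarrow> nat \<Rightarrow> real" where
  "alpha_seq n 0 = 0"
| "alpha_seq n (Suc k) =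
     (4 * (alpha_seq n k + 1) - real n
        + sqrt (real n * (16 * (alpha_seq n k)\<^sup>2 + 24 * alpha_seq n k + real n + 8)))
     / (4 * (real n - 1))"

primrec beta_seq :: "nat \<Rightarrow> real \<Rightarrow> nat \<Rightarrow> real" where
  "beta_seq n p 0 = sqrt (2 / (p + 1))"
| "beta_seq n p (Suc k) =
     sqrt (2 / (p + 1) + 4 / ((p + 1) * real n) * alpha_seq n k * (beta_seq n p k)\<^sup>2)"

definition I3 :: "nat \<Rightarrow> real \<Rightarrow> nat \<Rightarrow> real" where
  "I3 n p k =
     4 / real n * alpha_seq n (Suc k) * beta_seq n p k * (alpha_seq n (Suc k) + alpha_seq n k + 1)
     + beta_seq n p (Suc k) * alpha_seq n (Suc k)
     - (p + 1) * beta_seq n p (Suc k) * alpha_seq n (Suc k)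
     + (p + 1) / 2 * ((p - 1) / 2 - alpha_seq n (Suc k)) * beta_seq n p (Suc k)"

definition A_seq :: "nat \<Rightarrow> real \<Rightarrow> nat \<Rightarrow> real" where
  "A_seq n p k =
     2 * (real n - 2) * I3 n p k
     / (beta_seq n p (Suc k) * ((p + 1) / 2 - alpha_seq n (Suc k))\<^sup>2 - I3 n p k)"

(* Scalar curvature of the conformal metric u^(4/(n-4)) g_0 on R^n, for positive u. *)
definition conformal_scalar_curvature ::
  "(real ^ 'n::finite \<Rightarrow> real) \<Rightarrow> real ^ 'n \<Rightarrow> real" where
  "conformal_scalar_curvature u x =
     (let n = real CARD('n) in
        - (4 * (n - 1) / (n - 2)) * u x powr (- ((n + 2) / (n - 4)))
          * laplacian (\<lambda>y. u y powr ((n - 2) / (n - 4))) x)"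

end

(* With E = |grad u|^2/u, b = a/2, q = (p+1)/2, F = |x|^b u^q and L = Laplacian of u, the scalar
   curvature is a negative multiple of L + 2/(n-4) E, so a bound L <= - 2/(n-4) E - beta F with
   beta > 0 is the goal. It is the limit of the bounds L <= - alpha_k E - beta_k F.

   The start L <= 0 holds since averages of L over growing balls are nondecreasing, so that a
   positive value of L at some point would force the averages of u to grow quadratically. For the
   induction step let w = L + alpha E + beta F with the new constants. Bounding the norm of the
   shifted Hessian of u from below by its trace and inserting the previous bound, the recursion for alpha_k, beta_k and the condition on
   A_k yield Lap w >= (2 alpha/u) grad u . grad w + (- alpha E + q beta F) w/u. On w > 0 the
   term with the wrong sign is absorbed by considering w/sqrt u, and at an interior maximum of
   (R^2 - |x|^2)^2 w/sqrt u this gives w/u <= C R^2/(R^2 - |x|^2)^2, with no condition on the growth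
   of w; R -> infinity shows w <= 0.

   For a > 0 the bound is not strict at the origin, where F = 0. There the weak maximum principle
   on a small ball is applied to L + 2/(n-4) E, which is negative on its boundary. *)

theory Submission imports Defs begin

section \<open>Second-order jets and partial derivatives\<close>

text \<open>The constants come from writing the difference of the two sides of the inequality for
  Lap w as a sum of terms that can be signed separately. With primes for the previous constants, E^2
  has the factor (2/n)(1 + alpha + alpha')^2 - 2 alpha^2 - alpha, and alpha_{k+1} makes it vanish.
  The positive fixed point 2/(n-4) equals m - 1 for the exponent m = (n-2)/(n-4) in S_g, and
  Lap(u^m) is a positive multiple of L + (m-1) E. The coefficient of F^2 limits beta. The mixed term
  E F has coefficient I^(3) and must compensate the derivatives of |x|^b; together they form a
  quadratic expression in the gradient, and a <= A_k is its discriminant condition. The obstacle is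
  that L is uncontrolled at infinity. It is overcome because L <= 0 gives w <= alpha E + beta F:
  once the zeroth-order coefficient is a positive combination of E and F, it controls w/u by itself,
  and a cutoff suffices. No A_k governs the passage from L <= 0 to the bound with alpha_0, beta_0;
  that step rests on the lower bound for p.\<close>

definition has_two_derivs :: "(real \<Rightarrow> real) \<Rightarrow> real \<Rightarrow> real \<Rightarrow> bool" where
  "has_two_derivs g a b \<longleftrightarrow>
     (\<exists>g1. (\<forall>\<^sub>F t in nhds 0. (g has_real_derivative g1 t) (at t)) \<and> g1 0 = a
       \<and> (g1 has_real_derivative b) (at 0))"

lemma has_two_derivsI:
  assumes "\<forall>\<^sub>F t in nhds 0. (g has_real_derivative g1 t) (at t)"
    and "(g1 has_real_derivative b) (at 0)" "g1 0 = a"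
  shows "has_two_derivs g a b"
  using assms unfolding has_two_derivs_def by blast

lemma has_two_derivsE:
  assumes "has_two_derivs g a b"
  obtains g1 where "\<forall>\<^sub>F t in nhds 0. (g has_real_derivative g1 t) (at t)" "g1 0 = a"
    "(g1 has_real_derivative b) (at 0)" "(g has_real_derivative a) (at 0)"
  using assms eventually_nhds_x_imp_x unfolding has_two_derivs_def by metis

lemma has_two_derivs_const: "has_two_derivs (\<lambda>t. c) 0 0"
  by (rule has_two_derivsI[where ?g1.0 = "\<lambda>t. 0"]) auto

lemma has_two_derivs_add:
  assumes "has_two_derivs f a b" "has_two_derivs g c d"
  shows "has_two_derivs (\<lambda>t. f t + g t) (a + c) (b + d)"
proof -
  obtain f1 where f: "\<forall>\<^sub>F t in nhds 0. (f has_real_derivative f1 t) (at t)" "f1 0 = a"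
    "(f1 has_real_derivative b) (at 0)"
    by (rule has_two_derivsE[OF assms(1)])
  obtain g1 where g: "\<forall>\<^sub>F t in nhds 0. (g has_real_derivative g1 t) (at t)" "g1 0 = c"
    "(g1 has_real_derivative d) (at 0)"
    by (rule has_two_derivsE[OF assms(2)])
  show ?thesis
  proof (rule has_two_derivsI)
    show "\<forall>\<^sub>F t in nhds 0. ((\<lambda>t. f t + g t) has_real_derivative (f1 t + g1 t)) (at t)"
      using f(1) g(1) by eventually_elim (auto intro!: derivative_eq_intros)
    show "((\<lambda>t. f1 t + g1 t) has_real_derivative b + d) (at 0)"
      using f(3) g(3) by (auto intro!: derivative_eq_intros)
  qed (use f g in auto)
qed

lemma has_two_derivs_mult:
  assumes "has_two_derivs f a b" "has_two_derivs g c d"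
  shows "has_two_derivs (\<lambda>t. f t * g t) (a * g 0 + f 0 * c) (b * g 0 + 2 * a * c + f 0 * d)"
proof -
  obtain f1 where f: "\<forall>\<^sub>F t in nhds 0. (f has_real_derivative f1 t) (at t)" "f1 0 = a"
    "(f1 has_real_derivative b) (at 0)" "(f has_real_derivative a) (at 0)"
    by (rule has_two_derivsE[OF assms(1)])
  obtain g1 where g: "\<forall>\<^sub>F t in nhds 0. (g has_real_derivative g1 t) (at t)" "g1 0 = c"
    "(g1 has_real_derivative d) (at 0)" "(g has_real_derivative c) (at 0)"
    by (rule has_two_derivsE[OF assms(2)])
  show ?thesis
  proof (rule has_two_derivsI)
    show "\<forall>\<^sub>F t in nhds 0.
        ((\<lambda>t. f t * g t) has_real_derivative (f1 t * g t + f t * g1 t)) (at t)"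
      using f(1) g(1) by eventually_elim (auto intro!: derivative_eq_intros)
    show "((\<lambda>t. f1 t * g t + f t * g1 t) has_real_derivative b * g 0 + 2 * a * c + f 0 * d) (at 0)"
      using f g by (auto intro!: derivative_eq_intros simp: algebra_simps)
  qed (use f g in auto)
qed

text \<open>Continuity of \<open>g\<close> at 0 makes it enough to know \<open>\<phi>\<close> near
  \<open>g 0\<close>. In this local form the rule covers real powers and reciprocals, which are
  differentiable only on the positive axis.\<close>

lemma has_two_derivs_compose:
  assumes "\<forall>\<^sub>F y in nhds (g 0). (\<phi> has_real_derivative \<phi>1 y) (at y)"
    and "(\<phi>1 has_real_derivative c) (at (g 0))"
    and "has_two_derivs g a b"
  shows "has_two_derivs (\<lambda>t. \<phi> (g t)) (\<phi>1 (g 0) * a) (c * a\<^sup>2 + \<phi>1 (g 0) * b)"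
proof -
  obtain g1 where g: "\<forall>\<^sub>F t in nhds 0. (g has_real_derivative g1 t) (at t)" "g1 0 = a"
    "(g1 has_real_derivative b) (at 0)" "(g has_real_derivative a) (at 0)"
    by (rule has_two_derivsE[OF assms(3)])
  have "isCont g 0"
    using g(4) by (rule DERIV_isCont)
  then have "filterlim g (nhds (g 0)) (nhds 0)"
    by (simp add: continuous_at tendsto_at_iff_tendsto_nhds)
  then have ev: "\<forall>\<^sub>F t in nhds 0. (\<phi> has_real_derivative \<phi>1 (g t)) (at (g t))"
    by (rule eventually_compose_filterlim[OF assms(1)])
  show ?thesis
  proof (rule has_two_derivsI)
    show "\<forall>\<^sub>F t in nhds 0. ((\<lambda>t. \<phi> (g t)) has_real_derivative (\<phi>1 (g t) * g1 t)) (at t)"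
      using ev g(1) by eventually_elim (rule DERIV_chain2)
    have "((\<lambda>t. \<phi>1 (g t)) has_real_derivative c * a) (at 0)"
      using assms(2) g(4) by (rule DERIV_chain2)
    then show "((\<lambda>t. \<phi>1 (g t) * g1 t) has_real_derivative c * a\<^sup>2 + \<phi>1 (g 0) * b) (at 0)"
      using g by (auto intro!: derivative_eq_intros simp: power2_eq_square)
  qed (use g in auto)
qed

text \<open>A positive second derivative would make the first derivative, which vanishes at 0,
  positive just to the right of 0; by the mean value theorem \<open>g\<close> would then rise above
  its maximum.\<close>

lemma has_two_derivs_local_max:
  assumes "has_two_derivs g a b" and max: "\<forall>\<^sub>F t in nhds 0. g t \<le> g 0"
  shows "a = 0" "b \<le> 0"
proof -
  obtain g1 where g: "\<forall>\<^sub>F t in nhds 0. (g has_real_derivative g1 t) (at t)" "g1 0 = a"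
    "(g1 has_real_derivative b) (at 0)" "(g has_real_derivative a) (at 0)"
    by (rule has_two_derivsE[OF assms(1)])
  obtain d where d: "d > 0" "\<And>t. \<bar>t\<bar> < d \<Longrightarrow> g t \<le> g 0 \<and> (g has_real_derivative g1 t) (at t)"
    using eventually_conj[OF max g(1)] unfolding eventually_nhds_metric
    by (auto simp: dist_real_def)
  show a: "a = 0"
    by (rule DERIV_local_max[OF g(4) d(1)]) (use d in auto)
  show "b \<le> 0"
  proof (rule ccontr)
    assume "\<not> b \<le> 0"
    then obtain e where e: "e > 0" "\<And>h. 0 < h \<Longrightarrow> h < e \<Longrightarrow> g1 0 < g1 (0 + h)"
      using DERIV_pos_inc_right[OF g(3)] by auto
    define h where "h = min d e / 2"
    have h: "0 < h" "h < d" "h < e"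
      using d(1) e(1) by (auto simp: h_def)
    obtain z where z: "0 < z" "z < h" "g h - g 0 = (h - 0) * g1 z"
      using MVT2[of 0 h g g1] d(2) h by auto
    then have "g1 z > 0"
      using e(2)[of z] g(2) a h by auto
    then have "g h > g 0"
      using z h by (auto simp: algebra_simps)
    then show False
      using d(2)[of h] h by auto
  qed
qed

text \<open>Second-order jets: \<open>G\<close> is the gradient and \<open>L\<close> the Laplacian of \<open>f\<close> at \<open>x\<close>. Only
  derivatives along the coordinate lines through \<open>x\<close> enter, so the calculus rules reduce to one
  variable, and this is all that the maximum principle needs.\<close>

definition has_jet2 :: "(real ^ 'n::finite \<Rightarrow> real) \<Rightarrow> real ^ 'n \<Rightarrow> real ^ 'n \<Rightarrow> real \<Rightarrow> bool" where
  "has_jet2 f x G L \<longleftrightarrow>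
     (\<exists>S. (\<forall>i. has_two_derivs (\<lambda>t. f (x + t *\<^sub>R axis i 1)) (G $ i) (S i)) \<and> L = sum S UNIV)"

lemma has_jet2_const: "has_jet2 (\<lambda>y. c) x 0 0"
  unfolding has_jet2_def by (intro exI[of _ "\<lambda>i. 0"]) (auto intro: has_two_derivs_const)

lemma has_jet2_add:
  assumes "has_jet2 f x G L" "has_jet2 g x H M"
  shows "has_jet2 (\<lambda>y. f y + g y) x (G + H) (L + M)"
proof -
  obtain S T where S: "\<And>i. has_two_derivs (\<lambda>t. f (x + t *\<^sub>R axis i 1)) (G $ i) (S i)" "L = sum S UNIV"
    and T: "\<And>i. has_two_derivs (\<lambda>t. g (x + t *\<^sub>R axis i 1)) (H $ i) (T i)" "M = sum T UNIV"
    using assms unfolding has_jet2_def by blast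
  show ?thesis
    unfolding has_jet2_def
    by (rule exI[of _ "\<lambda>i. S i + T i"]) (auto simp: sum.distrib S T intro!: has_two_derivs_add S T)
qed

lemma has_jet2_mult:
  assumes "has_jet2 f x G L" "has_jet2 g x H M"
  shows "has_jet2 (\<lambda>y. f y * g y) x (g x *\<^sub>R G + f x *\<^sub>R H) (L * g x + 2 * (G \<bullet> H) + f x * M)"
proof -
  obtain S T where S: "\<And>i. has_two_derivs (\<lambda>t. f (x + t *\<^sub>R axis i 1)) (G $ i) (S i)" "L = sum S UNIV"
    and T: "\<And>i. has_two_derivs (\<lambda>t. g (x + t *\<^sub>R axis i 1)) (H $ i) (T i)" "M = sum T UNIV"
    using assms unfolding has_jet2_def by blast
  have eq: "L * g x + 2 * (G \<bullet> H) + f x * M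
      = (\<Sum>i\<in>UNIV. S i * g x + 2 * G $ i * H $ i + f x * T i)"
    by (simp add: S T sum.distrib inner_vec_def sum_distrib_left sum_distrib_right mult.assoc)
  show ?thesis
    unfolding has_jet2_def
  proof (intro exI[of _ "\<lambda>i. S i * g x + 2 * G $ i * H $ i + f x * T i"] conjI allI eq)
    fix i
    show "has_two_derivs (\<lambda>t. f (x + t *\<^sub>R axis i 1) * g (x + t *\<^sub>R axis i 1))
      ((g x *\<^sub>R G + f x *\<^sub>R H) $ i) (S i * g x + 2 * G $ i * H $ i + f x * T i)"
      using has_two_derivs_mult[OF S(1)[of i] T(1)[of i]] by (simp add: algebra_simps)
  qed
qed

lemma has_jet2_scale:
  assumes "has_jet2 f x G L"
  shows "has_jet2 (\<lambda>y. c * f y) x (c *\<^sub>R G) (c * L)"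
  using has_jet2_mult[OF has_jet2_const[of c x] assms] by simp

lemma has_jet2_sum:
  assumes "finite A" "\<And>j. j \<in> A \<Longrightarrow> has_jet2 (f j) x (G j) (L j)"
  shows "has_jet2 (\<lambda>y. \<Sum>j\<in>A. f j y) x (\<Sum>j\<in>A. G j) (\<Sum>j\<in>A. L j)"
  using assms by (induction A rule: finite_induct) (auto intro!: has_jet2_const has_jet2_add)

lemma has_jet2_compose:
  assumes "\<forall>\<^sub>F y in nhds (f x). (\<phi> has_real_derivative \<phi>1 y) (at y)"
    and "(\<phi>1 has_real_derivative c) (at (f x))"
    and "has_jet2 f x G L"
  shows "has_jet2 (\<lambda>y. \<phi> (f y)) x (\<phi>1 (f x) *\<^sub>R G) (c * (G \<bullet> G) + \<phi>1 (f x) * L)"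
proof -
  obtain S where S: "\<And>i. has_two_derivs (\<lambda>t. f (x + t *\<^sub>R axis i 1)) (G $ i) (S i)" "L = sum S UNIV"
    using assms unfolding has_jet2_def by blast
  have eq: "c * (G \<bullet> G) + \<phi>1 (f x) * L = (\<Sum>i\<in>UNIV. c * (G $ i)\<^sup>2 + \<phi>1 (f x) * S i)"
    by (simp add: S sum.distrib inner_vec_def sum_distrib_left power2_eq_square)
  show ?thesis
    unfolding has_jet2_def
  proof (intro exI[of _ "\<lambda>i. c * (G $ i)\<^sup>2 + \<phi>1 (f x) * S i"] conjI allI eq)
    fix i
    show "has_two_derivs (\<lambda>t. \<phi> (f (x + t *\<^sub>R axis i 1)))
      ((\<phi>1 (f x) *\<^sub>R G) $ i) (c * (G $ i)\<^sup>2 + \<phi>1 (f x) * S i)"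
      using has_two_derivs_compose[OF _ _ S(1)[of i], of \<phi> \<phi>1 c] assms(1,2) by simp
  qed
qed

lemma has_jet2_powr:
  assumes "has_jet2 f x G L" "f x > 0"
  shows "has_jet2 (\<lambda>y. f y powr c) x ((c * f x powr (c - 1)) *\<^sub>R G)
    (c * (c - 1) * f x powr (c - 2) * (G \<bullet> G) + c * f x powr (c - 1) * L)"
proof -
  have "\<forall>\<^sub>F y in nhds (f x). y > 0"
    using assms(2) by (rule order_tendstoD(1)[OF filterlim_ident])
  then have "\<forall>\<^sub>F y in nhds (f x). ((\<lambda>y. y powr c) has_real_derivative c * y powr (c - 1)) (at y)"
    by eventually_elim (rule has_real_derivative_powr)
  moreover have "((\<lambda>y. c * y powr (c - 1)) has_real_derivative c * (c - 1) * f x powr (c - 2)) (at (f x))"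
    using DERIV_cmult[OF has_real_derivative_powr[OF assms(2), of "c - 1"], of c]
    by (simp add: mult.assoc)
  ultimately show ?thesis
    using has_jet2_compose[OF _ _ assms(1), of "\<lambda>y. y powr c" "\<lambda>y. c * y powr (c - 1)"] by blast
qed

lemma has_jet2_local_max:
  assumes "has_jet2 f x G L" and max: "\<forall>\<^sub>F y in nhds x. f y \<le> f x"
  shows "G = 0" "L \<le> 0"
proof -
  obtain S where S: "\<And>i. has_two_derivs (\<lambda>t. f (x + t *\<^sub>R axis i 1)) (G $ i) (S i)" "L = sum S UNIV"
    using assms unfolding has_jet2_def by blast
  have "\<forall>\<^sub>F t in nhds 0. f (x + t *\<^sub>R axis i 1) \<le> f (x + 0 *\<^sub>R axis i 1)" for i
  proof -
    have "filterlim (\<lambda>t::real. x + t *\<^sub>R axis i 1) (nhds x) (nhds 0)"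
      by (auto intro!: tendsto_eq_intros filterlim_ident)
    then show ?thesis
      using eventually_compose_filterlim[OF max] by simp
  qed
  then have "G $ i = 0" "S i \<le> 0" for i
    using has_two_derivs_local_max[OF S(1)[of i]] by auto
  then show "G = 0" "L \<le> 0"
    by (auto simp: vec_eq_iff S(2) intro: sum_nonpos)
qed

lemma has_jet2_inner_self: "has_jet2 (\<lambda>y::real^'n::finite. y \<bullet> y) x (2 *\<^sub>R x) (2 * real CARD('n))"
  unfolding has_jet2_def
proof (intro exI[of _ "\<lambda>i. 2"] conjI allI)
  fix i :: 'n
  have eq: "(x + t *\<^sub>R axis i 1) \<bullet> (x + t *\<^sub>R axis i 1) = x \<bullet> x + 2 * t * x $ i + t\<^sup>2" for t
    by (simp add: inner_simps inner_axis inner_commute[of "axis i 1" x] power2_eq_square algebra_simps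
        inner_axis_axis)
  show "has_two_derivs (\<lambda>t. (x + t *\<^sub>R axis i 1) \<bullet> (x + t *\<^sub>R axis i 1)) ((2 *\<^sub>R x) $ i) 2"
    unfolding eq
    by (rule has_two_derivsI[where ?g1.0 = "\<lambda>t. 2 * x $ i + 2 * t"])
      (auto intro!: derivative_eq_intros always_eventually)
qed auto

lemma has_jet2_norm_powr:
  fixes x :: "real^'n::finite"
  assumes "x \<noteq> 0"
  shows "has_jet2 (\<lambda>y. norm y powr b) x ((b * norm x powr b / (x \<bullet> x)) *\<^sub>R x)
     (b * (real CARD('n) - 2 + b) * norm x powr b / (x \<bullet> x))"
proof -
  have pos: "x \<bullet> x > 0"
    using assms by simp
  have eq: "norm y powr b = (y \<bullet> y) powr (b / 2)" for y :: "real^'n"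
  proof -
    have "norm y = (y \<bullet> y) powr (1 / 2)"
      by (simp add: norm_eq_sqrt_inner powr_half_sqrt)
    then show ?thesis
      by (simp add: powr_powr)
  qed
  have p1: "(x \<bullet> x) powr (b / 2 - 1) = norm x powr b / (x \<bullet> x)"
    using pos by (simp add: powr_diff eq)
  have p2: "(x \<bullet> x) powr (b / 2 - 2) * (x \<bullet> x) = norm x powr b / (x \<bullet> x)"
    using pos by (simp add: powr_diff eq power2_eq_square)
  let ?L = "b / 2 * (b / 2 - 1) * (x \<bullet> x) powr (b / 2 - 2) * ((2 *\<^sub>R x) \<bullet> (2 *\<^sub>R x))
      + b / 2 * (x \<bullet> x) powr (b / 2 - 1) * (2 * real CARD('n))"
  have "?L = 4 * (b / 2 * (b / 2 - 1)) * ((x \<bullet> x) powr (b / 2 - 2) * (x \<bullet> x))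
      + b / 2 * (x \<bullet> x) powr (b / 2 - 1) * (2 * real CARD('n))"
    by simp
  also have "\<dots> = b * (real CARD('n) - 2 + b) * norm x powr b / (x \<bullet> x)"
    unfolding p1 p2 using pos by (simp add: field_simps)
  finally have L: "?L = b * (real CARD('n) - 2 + b) * norm x powr b / (x \<bullet> x)" .
  have "has_jet2 (\<lambda>y. (y \<bullet> y) powr (b / 2)) x ((b / 2 * (x \<bullet> x) powr (b / 2 - 1)) *\<^sub>R (2 *\<^sub>R x)) ?L"
    by (rule has_jet2_powr[OF has_jet2_inner_self pos])
  then show ?thesis
    unfolding L unfolding eq[symmetric] p1 by simp
qed

section \<open>Classical derivatives, their relation to jets, and symmetry of mixed
  derivatives\<close>

lemma C_k_continuous: "C_k k f \<Longrightarrow> continuous_on UNIV f"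
  by (cases k) (auto simp: differentiable_on_def intro!: differentiable_imp_continuous_on
      differentiable_at_withinI)

lemma partial_deriv_has_derivative:
  assumes "f differentiable at (x + t *\<^sub>R axis i 1)"
  shows "((\<lambda>t. f (x + t *\<^sub>R axis i 1)) has_real_derivative partial_deriv i f (x + t *\<^sub>R axis i 1)) (at t)"
proof -
  let ?D = "frechet_derivative f (at (x + t *\<^sub>R axis i 1))"
  have D: "(f has_derivative ?D) (at (x + t *\<^sub>R axis i 1))"
    using assms frechet_derivative_works by blast
  have "((\<lambda>t::real. x + t *\<^sub>R axis i 1) has_derivative (\<lambda>h. h *\<^sub>R axis i 1)) (at t)"
    by (auto intro!: derivative_eq_intros)
  from has_derivative_compose[OF this D]
  have "((\<lambda>t. f (x + t *\<^sub>R axis i 1)) has_derivative (\<lambda>h. ?D (h *\<^sub>R axis i 1))) (at t)" .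
  moreover have "(\<lambda>h. ?D (h *\<^sub>R axis i 1)) = (*) (partial_deriv i f (x + t *\<^sub>R axis i 1))"
    using linear_frechet_derivative[OF assms] by (auto simp: linear_scale partial_deriv_def)
  ultimately show ?thesis
    by (simp add: has_field_derivative_def)
qed

text \<open>\<open>partial_deriv\<close> is read off a Frechet derivative, so a derivative along a
  line determines it only where differentiability is already known. This is the bridge between the
  two notions.\<close>

lemma partial_deriv_eq_line:
  assumes "f differentiable at x" "((\<lambda>t. f (x + t *\<^sub>R axis i 1)) has_real_derivative d) (at 0)"
  shows "partial_deriv i f x = d"
  using partial_deriv_has_derivative[of f x 0 i] assms by (auto intro: DERIV_unique)

lemma has_derivative_partial_deriv:
  assumes "f differentiable at x"
  shows "(f has_derivative (\<lambda>h. \<Sum>i\<in>UNIV. h $ i * partial_deriv i f x)) (at x)"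
proof -
  let ?D = "frechet_derivative f (at x)"
  have lin: "linear ?D"
    using assms by (rule linear_frechet_derivative)
  have "?D h = (\<Sum>i\<in>UNIV. h $ i * partial_deriv i f x)" for h
  proof -
    have "h = (\<Sum>i\<in>UNIV. h $ i *\<^sub>R axis i 1)"
      using basis_expansion[of h] by (simp add: scalar_mult_eq_scaleR)
    then have "?D h = ?D (\<Sum>i\<in>UNIV. h $ i *\<^sub>R axis i 1)"
      by simp
    then show ?thesis
      by (simp add: linear_sum[OF lin] linear_scale[OF lin] partial_deriv_def)
  qed
  then have "?D = (\<lambda>h. \<Sum>i\<in>UNIV. h $ i * partial_deriv i f x)"
    by auto
  with assms show ?thesis
    using frechet_derivative_works by metis
qed

lemma partial_deriv_sum:
  assumes "finite A" "\<And>j. j \<in> A \<Longrightarrow> f j differentiable at x"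
  shows "partial_deriv i (\<lambda>x. \<Sum>j\<in>A. f j x) x = (\<Sum>j\<in>A. partial_deriv i (f j) x)"
proof (rule partial_deriv_eq_line)
  show "(\<lambda>x. \<Sum>j\<in>A. f j x) differentiable at x"
    using assms by (intro differentiable_sum) auto
  have "((\<lambda>t. f j (x + t *\<^sub>R axis i 1)) has_real_derivative partial_deriv i (f j) x) (at 0)"
    if "j \<in> A" for j
    using partial_deriv_has_derivative[of "f j" x 0 i] assms(2)[OF that] by simp
  then show "((\<lambda>t. \<Sum>j\<in>A. f j (x + t *\<^sub>R axis i 1)) has_real_derivative
      (\<Sum>j\<in>A. partial_deriv i (f j) x)) (at 0)"
    by (rule DERIV_sum)
qed

lemma C_k_sum:
  assumes "finite A" "\<And>j. j \<in> A \<Longrightarrow> C_k k (f j)"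
  shows "C_k k (\<lambda>x. \<Sum>j\<in>A. f j x)"
  using assms(2)
proof (induction k arbitrary: f)
  case 0
  then show ?case by (auto intro: continuous_on_sum)
next
  case (Suc k)
  have diff: "f j differentiable at x" if "j \<in> A" for j x
    using Suc.prems[OF that] by simp
  have "partial_deriv i (\<lambda>x. \<Sum>j\<in>A. f j x) = (\<lambda>x. \<Sum>j\<in>A. partial_deriv i (f j) x)" for i
    using partial_deriv_sum[OF assms(1)] diff by blast
  moreover have "C_k k (\<lambda>x. \<Sum>j\<in>A. partial_deriv i (f j) x)" for i
    using Suc.prems by (intro Suc.IH) auto
  ultimately show ?case
    using diff assms(1) by (auto intro!: differentiable_sum)
qed

lemma C_k_laplacian: "C_k (Suc (Suc k)) f \<Longrightarrow> C_k k (laplacian f)"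
  unfolding laplacian_def[abs_def] by (rule C_k_sum) auto

lemma has_jet2_C_k:
  assumes "C_k (Suc (Suc k)) f"
  shows "has_jet2 f x (\<chi> i. partial_deriv i f x) (laplacian f x)"
  unfolding has_jet2_def
proof (intro exI[of _ "\<lambda>i. partial_deriv i (partial_deriv i f) x"] conjI allI)
  fix i
  have *: "f differentiable at y" "partial_deriv i f differentiable at y" for y
    using assms by auto
  show "has_two_derivs (\<lambda>t. f (x + t *\<^sub>R axis i 1)) ((\<chi> i. partial_deriv i f x) $ i)
      (partial_deriv i (partial_deriv i f) x)"
  proof (rule has_two_derivsI)
    show "\<forall>\<^sub>F t in nhds 0. ((\<lambda>t. f (x + t *\<^sub>R axis i 1)) has_real_derivative
        partial_deriv i f (x + t *\<^sub>R axis i 1)) (at t)"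
      by (intro always_eventually allI partial_deriv_has_derivative *)
    show "((\<lambda>t. partial_deriv i f (x + t *\<^sub>R axis i 1)) has_real_derivative
        partial_deriv i (partial_deriv i f) x) (at 0)"
      using partial_deriv_has_derivative[of "partial_deriv i f" x 0 i] * by simp
  qed auto
qed (simp add: laplacian_def)

text \<open>Two applications of the mean value theorem: in direction \<open>i\<close> to the
  increment of \<open>f\<close> in direction \<open>j\<close>, then in direction \<open>j\<close> to
  \<open>partial_deriv i f\<close>.\<close>

lemma second_difference_eq_partial_deriv:
  assumes "\<And>y. f differentiable at y" "\<And>y. partial_deriv i f differentiable at y" and "h > 0"
  shows "\<exists>y. dist y x < 2 * h \<and>
    f (x + h *\<^sub>R axis i 1 + h *\<^sub>R axis j 1) - f (x + h *\<^sub>R axis i 1) - f (x + h *\<^sub>R axis j 1) + f x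
      = h\<^sup>2 * partial_deriv j (partial_deriv i f) y"
proof -
  define g where "g s = f (x + h *\<^sub>R axis j 1 + s *\<^sub>R axis i 1) - f (x + s *\<^sub>R axis i 1)" for s
  have "(g has_real_derivative partial_deriv i f (x + h *\<^sub>R axis j 1 + s *\<^sub>R axis i 1)
      - partial_deriv i f (x + s *\<^sub>R axis i 1)) (at s)" for s
    unfolding g_def using assms(1) by (intro DERIV_diff partial_deriv_has_derivative) auto
  then obtain s where s: "0 < s" "s < h"
    "g h - g 0 = (h - 0) * (partial_deriv i f (x + h *\<^sub>R axis j 1 + s *\<^sub>R axis i 1)
      - partial_deriv i f (x + s *\<^sub>R axis i 1))"
    using MVT2[of 0 h g "\<lambda>s. partial_deriv i f (x + h *\<^sub>R axis j 1 + s *\<^sub>R axis i 1)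
      - partial_deriv i f (x + s *\<^sub>R axis i 1)"] assms(3) by blast
  define k where "k t = partial_deriv i f (x + s *\<^sub>R axis i 1 + t *\<^sub>R axis j 1)" for t
  have "(k has_real_derivative
      partial_deriv j (partial_deriv i f) (x + s *\<^sub>R axis i 1 + t *\<^sub>R axis j 1)) (at t)" for t
    unfolding k_def using assms(2) by (intro partial_deriv_has_derivative) auto
  then obtain t where t: "0 < t" "t < h"
    "k h - k 0 = (h - 0) * partial_deriv j (partial_deriv i f) (x + s *\<^sub>R axis i 1 + t *\<^sub>R axis j 1)"
    using MVT2[of 0 h k "\<lambda>t. partial_deriv j (partial_deriv i f) (x + s *\<^sub>R axis i 1 + t *\<^sub>R axis j 1)"]
      assms(3) by blast
  let ?y = "x + s *\<^sub>R axis i 1 + t *\<^sub>R axis j 1"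
  have "dist ?y x = norm (s *\<^sub>R axis i (1::real) + t *\<^sub>R axis j 1)"
    by (simp add: dist_norm)
  also have "\<dots> \<le> norm (s *\<^sub>R axis i (1::real)) + norm (t *\<^sub>R axis j (1::real) :: real^'a)"
    by (rule norm_triangle_ineq)
  also have "\<dots> < 2 * h"
    using s t by simp
  finally have "dist ?y x < 2 * h" .
  moreover have "g h - g 0 = h * (k h - k 0)"
    using s by (simp add: k_def algebra_simps)
  then have "g h - g 0 = h\<^sup>2 * partial_deriv j (partial_deriv i f) ?y"
    using t by (simp add: power2_eq_square)
  ultimately show ?thesis
    by (intro exI[of _ ?y]) (simp add: g_def algebra_simps)
qed

text \<open>The second difference is symmetric in \<open>i\<close> and \<open>j\<close>, hence
  equals h^2 times either mixed derivative, each taken at some point within 2h of \<open>x\<close>.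
  Continuity of both then excludes different values at \<open>x\<close>.\<close>

lemma partial_deriv_commute:
  assumes "C_k (Suc (Suc k)) f"
  shows "partial_deriv i (partial_deriv j f) x = partial_deriv j (partial_deriv i f) x"
proof (rule ccontr)
  let ?p = "partial_deriv i (partial_deriv j f)" and ?q = "partial_deriv j (partial_deriv i f)"
  assume ne: "?p x \<noteq> ?q x"
  have diff: "f differentiable at y" "partial_deriv i f differentiable at y" for y i
    using assms by auto
  have "continuous_on UNIV ?p" "continuous_on UNIV ?q"
    using assms by (auto intro: C_k_continuous[of k])
  then have cont: "isCont ?p x" "isCont ?q x"
    by (auto simp: continuous_on_eq_continuous_at)
  define e where "e = dist (?p x) (?q x) / 2"
  have e: "e > 0"
    using ne by (simp add: e_def)
  obtain d1 where d1: "d1 > 0" "\<And>y. dist y x < d1 \<Longrightarrow> dist (?p y) (?p x) < e"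
    using cont(1) e unfolding continuous_at_eps_delta by blast
  obtain d2 where d2: "d2 > 0" "\<And>y. dist y x < d2 \<Longrightarrow> dist (?q y) (?q x) < e"
    using cont(2) e unfolding continuous_at_eps_delta by blast
  define h where "h = min d1 d2 / 2"
  have h: "h > 0" "2 * h \<le> d1" "2 * h \<le> d2"
    using d1 d2 by (auto simp: h_def)
  obtain y where y: "dist y x < 2 * h"
    "f (x + h *\<^sub>R axis j 1 + h *\<^sub>R axis i 1) - f (x + h *\<^sub>R axis j 1) - f (x + h *\<^sub>R axis i 1) + f x
      = h\<^sup>2 * ?p y"
    using second_difference_eq_partial_deriv[OF diff(1) diff(2) h(1)] by blast
  obtain z where z: "dist z x < 2 * h"
    "f (x + h *\<^sub>R axis i 1 + h *\<^sub>R axis j 1) - f (x + h *\<^sub>R axis i 1) - f (x + h *\<^sub>R axis j 1) + f x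
      = h\<^sup>2 * ?q z"
    using second_difference_eq_partial_deriv[OF diff(1) diff(2) h(1)] by blast
  have "h\<^sup>2 * ?p y = h\<^sup>2 * ?q z"
    using y(2) z(2) by (simp add: algebra_simps)
  then have "?p y = ?q z"
    using h by simp
  moreover have "dist (?p y) (?p x) < e" "dist (?q z) (?q x) < e"
    using y z h d1 d2 by auto
  ultimately have "dist (?p x) (?q x) < e + e"
    by (metis dist_commute dist_triangle_less_add)
  then show False
    by (simp add: e_def)
qed

lemma C_k_SucD: "C_k (Suc k) f \<Longrightarrow> C_k k f"
proof (induction k arbitrary: f)
  case 0
  show ?case using C_k_continuous[OF 0] by simp
qed auto

text \<open>This exchange is what brings the gradient of the Laplacian of u into the Bochner formula
  below.\<close>

lemma laplacian_partial_deriv: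
  assumes "C_k (Suc (Suc (Suc k))) f"
  shows "laplacian (partial_deriv j f) x = partial_deriv j (laplacian f) x"
proof -
  have C2: "C_k (Suc (Suc k)) f" "C_k (Suc (Suc k)) (partial_deriv i f)" for i
    using C_k_SucD[OF assms] assms by simp_all
  have "partial_deriv i (partial_deriv j f) = partial_deriv j (partial_deriv i f)" for i
    using partial_deriv_commute[OF C2(1)] by blast
  then have "laplacian (partial_deriv j f) x
      = (\<Sum>i\<in>UNIV. partial_deriv i (partial_deriv j (partial_deriv i f)) x)"
    by (simp add: laplacian_def)
  also have "\<dots> = (\<Sum>i\<in>UNIV. partial_deriv j (partial_deriv i (partial_deriv i f)) x)"
    by (intro sum.cong refl partial_deriv_commute[OF C2(2)])
  also have "\<dots> = partial_deriv j (laplacian f) x"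
    unfolding laplacian_def[abs_def] using assms by (subst partial_deriv_sum) auto
  finally show ?thesis .
qed

section \<open>The differential inequality\<close>

definition grad :: "(real ^ 'n::finite \<Rightarrow> real) \<Rightarrow> real ^ 'n \<Rightarrow> real ^ 'n" where
  "grad f x = (\<chi> i. partial_deriv i f x)"

definition grad_energy :: "(real ^ 'n::finite \<Rightarrow> real) \<Rightarrow> real ^ 'n \<Rightarrow> real" where
  "grad_energy u x = (grad u x \<bullet> grad u x) / u x"

lemma has_jet2_inverse:
  assumes "has_jet2 f x G L" "f x > 0"
  shows "has_jet2 (\<lambda>y. inverse (f y)) x ((- 1 / (f x)\<^sup>2) *\<^sub>R G) (2 / (f x)^3 * (G \<bullet> G) - L / (f x)\<^sup>2)"
proof -
  have "\<forall>\<^sub>F y in nhds (f x). y > 0"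
    using assms(2) by (rule order_tendstoD(1)[OF filterlim_ident])
  then have "\<forall>\<^sub>F y in nhds (f x). (inverse has_real_derivative - 1 / y\<^sup>2) (at y)"
    by eventually_elim (auto intro!: derivative_eq_intros simp: power2_eq_square field_simps)
  moreover have "((\<lambda>y. - 1 / y\<^sup>2) has_real_derivative 2 / (f x)^3) (at (f x))"
    using assms(2) by (auto intro!: derivative_eq_intros simp: power2_eq_square power3_eq_cube field_simps)
  ultimately have "has_jet2 (\<lambda>y. inverse (f y)) x ((- 1 / (f x)\<^sup>2) *\<^sub>R G)
      (2 / (f x)^3 * (G \<bullet> G) + (- 1 / (f x)\<^sup>2) * L)"
    by (rule has_jet2_compose[OF _ _ assms(1)])
  then show ?thesis
    by simp
qed

lemma trace_sq_le:
  fixes H :: "'n::finite \<Rightarrow> real ^ 'n"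
  shows "(\<Sum>j\<in>UNIV. H j $ j)\<^sup>2 \<le> real CARD('n) * (\<Sum>j\<in>UNIV. H j \<bullet> H j)"
proof -
  have "(\<Sum>j\<in>UNIV. H j $ j)\<^sup>2 \<le> real CARD('n) * (\<Sum>j\<in>UNIV. (H j $ j)\<^sup>2)"
    using sum_squared_le_sum_of_squares[of "\<lambda>j. H j $ j" UNIV] by (simp add: mult.commute)
  also have "(H j $ j)\<^sup>2 \<le> H j \<bullet> H j" for j
    using member_le_sum[of j UNIV "\<lambda>i. H j $ i * H j $ i"]
    by (simp add: power2_eq_square inner_vec_def)
  then have "real CARD('n) * (\<Sum>j\<in>UNIV. (H j $ j)\<^sup>2) \<le> real CARD('n) * (\<Sum>j\<in>UNIV. H j \<bullet> H j)"
    by (intro mult_left_mono sum_mono) auto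
  finally show ?thesis .
qed

text \<open>\<open>trace_sq_le\<close> for the shifted matrix H - c g g^T. For c = (1 + \<alpha>)/u
  its squared norm contains the Hessian terms of Lap(\<alpha> E) together with those of the
  first-order term (2 \<alpha>/u) grad u . grad w, which supplies the extra \<alpha> in 1 +
  \<alpha>.\<close>

lemma trace_shift_sq_le:
  fixes H :: "'n::finite \<Rightarrow> real ^ 'n" and g :: "real ^ 'n"
  shows "((\<Sum>j\<in>UNIV. H j $ j) - c * (g \<bullet> g))\<^sup>2 \<le> real CARD('n) *
    ((\<Sum>j\<in>UNIV. H j \<bullet> H j) - 2 * c * (\<Sum>j\<in>UNIV. g $ j * (H j \<bullet> g)) + c\<^sup>2 * (g \<bullet> g)\<^sup>2)"
proof -
  define K where "K j = H j - (c * g $ j) *\<^sub>R g" for j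
  have "(\<Sum>j\<in>UNIV. K j $ j) = (\<Sum>j\<in>UNIV. H j $ j) - c * (g \<bullet> g)"
    by (simp add: K_def sum_subtractf inner_vec_def sum_distrib_left mult.assoc)
  moreover have "K j \<bullet> K j = H j \<bullet> H j - 2 * c * (g $ j * (H j \<bullet> g)) + c\<^sup>2 * (g $ j * g $ j) * (g \<bullet> g)" for j
    by (simp add: K_def inner_simps inner_commute power2_eq_square algebra_simps)
  then have "(\<Sum>j\<in>UNIV. K j \<bullet> K j) = (\<Sum>j\<in>UNIV. H j \<bullet> H j)
      - 2 * c * (\<Sum>j\<in>UNIV. g $ j * (H j \<bullet> g)) + c\<^sup>2 * (\<Sum>j\<in>UNIV. g $ j * g $ j) * (g \<bullet> g)"
    by (simp add: sum.distrib sum_subtractf sum_distrib_left sum_distrib_right)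
  moreover have "(\<Sum>j\<in>UNIV. g $ j * g $ j) = g \<bullet> g"
    by (simp add: inner_vec_def)
  ultimately show ?thesis
    using trace_sq_le[of K] by (simp add: power2_eq_square mult.assoc)
qed

lemma has_jet2_grad:
  assumes "C_k (Suc (Suc k)) f"
  shows "has_jet2 f x (grad f x) (laplacian f x)"
  using has_jet2_C_k[OF assms] by (simp add: grad_def)

text \<open>Bochner's formula for |grad u|^2, combined with the product rule for the factor 1/u. The
  vectors \<open>H j\<close> are the rows of the Hessian.\<close>

lemma has_jet2_grad_energy:
  fixes u :: "real ^ 'n::finite \<Rightarrow> real"
  assumes C: "C_k (Suc (Suc (Suc k))) u" and pos: "u x > 0"
  defines "g \<equiv> grad u x" and "H \<equiv> \<lambda>j. grad (partial_deriv j u) x"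
  shows "has_jet2 (grad_energy u) x
    ((2 / u x) *\<^sub>R (\<Sum>j\<in>UNIV. g $ j *\<^sub>R H j) - ((g \<bullet> g) / (u x)\<^sup>2) *\<^sub>R g)
    ((2 * (g \<bullet> grad (laplacian u) x) + 2 * (\<Sum>j\<in>UNIV. H j \<bullet> H j)) / u x
      - 4 * (\<Sum>j\<in>UNIV. g $ j * (H j \<bullet> g)) / (u x)\<^sup>2
      + 2 * (g \<bullet> g)\<^sup>2 / (u x)^3 - (g \<bullet> g) * laplacian u x / (u x)\<^sup>2)"
proof -
  let ?gl = "grad (laplacian u) x" and ?U = "u x"
  let ?GH = "\<Sum>j\<in>UNIV. g $ j *\<^sub>R H j"
  have C2: "C_k (Suc (Suc k)) u" "C_k (Suc (Suc k)) (partial_deriv j u)" for j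
    using C_k_SucD[OF C] C by simp_all
  have Ju: "has_jet2 u x g (laplacian u x)"
    unfolding g_def by (rule has_jet2_grad[OF C2(1)])
  have Jj: "has_jet2 (partial_deriv j u) x (H j) (?gl $ j)" for j
    using has_jet2_grad[OF C2(2), of j x] laplacian_partial_deriv[OF C, of j x]
    by (simp add: H_def grad_def)
  have gj: "partial_deriv j u x = g $ j" for j
    by (simp add: g_def grad_def)
  have "has_jet2 (\<lambda>y. partial_deriv j u y * partial_deriv j u y) x (g $ j *\<^sub>R H j + g $ j *\<^sub>R H j)
      (?gl $ j * g $ j + 2 * (H j \<bullet> H j) + g $ j * ?gl $ j)" for j
    using has_jet2_mult[OF Jj[of j] Jj[of j]] unfolding gj .
  then have "has_jet2 (\<lambda>y. \<Sum>j\<in>UNIV. partial_deriv j u y * partial_deriv j u y) x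
      (\<Sum>j\<in>UNIV. g $ j *\<^sub>R H j + g $ j *\<^sub>R H j)
      (\<Sum>j\<in>UNIV. ?gl $ j * g $ j + 2 * (H j \<bullet> H j) + g $ j * ?gl $ j)"
    by (rule has_jet2_sum[OF finite])
  moreover have "(\<Sum>j\<in>UNIV. g $ j *\<^sub>R H j + g $ j *\<^sub>R H j) = 2 *\<^sub>R ?GH"
    by (simp add: scaleR_sum_right flip: scaleR_2)
  moreover have "(\<Sum>j\<in>UNIV. ?gl $ j * g $ j + 2 * (H j \<bullet> H j) + g $ j * ?gl $ j)
      = 2 * (g \<bullet> ?gl) + 2 * (\<Sum>j\<in>UNIV. H j \<bullet> H j)"
    by (simp add: sum.distrib inner_vec_def sum_distrib_left mult.commute)
  ultimately have JN: "has_jet2 (\<lambda>y. \<Sum>j\<in>UNIV. partial_deriv j u y * partial_deriv j u y) x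
      (2 *\<^sub>R ?GH) (2 * (g \<bullet> ?gl) + 2 * (\<Sum>j\<in>UNIV. H j \<bullet> H j))"
    by simp
  have N: "(\<Sum>j\<in>UNIV. partial_deriv j u x * partial_deriv j u x) = g \<bullet> g"
    by (simp add: inner_vec_def g_def grad_def)
  have fE: "grad_energy u = (\<lambda>y. (\<Sum>j\<in>UNIV. partial_deriv j u y * partial_deriv j u y) * inverse (u y))"
    by (simp add: fun_eq_iff grad_energy_def inner_vec_def grad_def divide_inverse)
  have Q: "?GH \<bullet> g = (\<Sum>j\<in>UNIV. g $ j * (H j \<bullet> g))"
    by (simp add: inner_sum_left)
  have J: "has_jet2 (grad_energy u) x
      (inverse ?U *\<^sub>R 2 *\<^sub>R ?GH + (g \<bullet> g) *\<^sub>R (- 1 / ?U\<^sup>2) *\<^sub>R g)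
      ((2 * (g \<bullet> ?gl) + 2 * (\<Sum>j\<in>UNIV. H j \<bullet> H j)) * inverse ?U
        + 2 * ((2 *\<^sub>R ?GH) \<bullet> ((- 1 / ?U\<^sup>2) *\<^sub>R g))
        + (g \<bullet> g) * (2 / ?U^3 * (g \<bullet> g) - laplacian u x / ?U\<^sup>2))"
    using has_jet2_mult[OF JN has_jet2_inverse[OF Ju pos]] unfolding fE N .
  have G: "inverse ?U *\<^sub>R 2 *\<^sub>R ?GH + (g \<bullet> g) *\<^sub>R (- 1 / ?U\<^sup>2) *\<^sub>R g
      = (2 / ?U) *\<^sub>R ?GH - ((g \<bullet> g) / ?U\<^sup>2) *\<^sub>R g"
    by (simp add: divide_inverse mult.commute)
  have L: "(2 * (g \<bullet> ?gl) + 2 * (\<Sum>j\<in>UNIV. H j \<bullet> H j)) * inverse ?U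
        + 2 * ((2 *\<^sub>R ?GH) \<bullet> ((- 1 / ?U\<^sup>2) *\<^sub>R g))
        + (g \<bullet> g) * (2 / ?U^3 * (g \<bullet> g) - laplacian u x / ?U\<^sup>2)
      = (2 * (g \<bullet> ?gl) + 2 * (\<Sum>j\<in>UNIV. H j \<bullet> H j)) / ?U
        - 4 * (\<Sum>j\<in>UNIV. g $ j * (H j \<bullet> g)) / ?U\<^sup>2
        + 2 * (g \<bullet> g)\<^sup>2 / ?U^3 - (g \<bullet> g) * laplacian u x / ?U\<^sup>2"
    unfolding inner_scaleR_left inner_scaleR_right Q
    by (simp add: divide_inverse power2_eq_square algebra_simps)
  show ?thesis
    using J unfolding G L .
qed

text \<open>The inequality at one point, with scalars for the geometric quantities: \<open>N\<close>
  = |grad u|^2, \<open>S\<close> the squared norm of the Hessian, \<open>Q\<close> the Hessian form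
  evaluated at grad u, \<open>D\<close> = grad u . grad f, \<open>T\<close> = u^q, \<open>P\<close>
  = f u^q, \<open>gl\<close> = grad u . grad (Lap u). The difference of the sides is the sum of four
  nonnegative terms: the excess in the trace inequality, the E^2 part, the P^2 part, and the mixed
  part with the derivatives of f.\<close>

lemma differential_inequality_algebra:
  fixes U :: real
  assumes U: "U > 0" and n: "n > 0"
    and X: "(L - (1 + \<alpha>) * (N / U))\<^sup>2 \<le> n * (S - 2 * ((1 + \<alpha>) / U) * Q + ((1 + \<alpha>) / U)\<^sup>2 * N\<^sup>2)"
    and bd: "L \<le> - \<alpha>' * (N / U) - \<beta>' * P"
    and nn: "0 \<le> \<alpha>" "0 \<le> \<alpha>'" "0 \<le> \<beta>'" "0 \<le> N" "0 \<le> P"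
    and c1: "0 \<le> \<alpha> * ((2 / n) * (1 + \<alpha> + \<alpha>')\<^sup>2 - 2 * \<alpha>\<^sup>2 - \<alpha>)"
    and c2: "q * \<beta>\<^sup>2 \<le> 1 + (2 * \<alpha> / n) * \<beta>'\<^sup>2"
    and quad: "0 \<le> \<beta> * (T * Lf + 2 * (q - \<alpha>) * T * D / U)
      + (4 / n * \<alpha> * \<beta>' * (\<alpha> + \<alpha>' + 1) + \<beta> * \<alpha> - 2 * q * \<beta> * \<alpha> + q * (q - 1 - \<alpha>) * \<beta>) * P * N / U\<^sup>2"
  shows "2 * \<alpha> / U * (gl + \<alpha> * (2 * Q / U - N\<^sup>2 / U\<^sup>2) + \<beta> * (T * D + P * q * N / U))
      + (- \<alpha> * (N / U) + q * \<beta> * P) / U * (L + \<alpha> * (N / U) + \<beta> * P)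
    \<le> P\<^sup>2 / U + \<alpha> * ((2 * gl + 2 * S) / U - 4 * Q / U\<^sup>2 + 2 * N\<^sup>2 / U^3 - N * L / U\<^sup>2)
      + \<beta> * (Lf * T + 2 * q * T * D / U + P * (q * (q - 1) * N / U\<^sup>2 + q * L / U))"
proof -
  define E where "E = N / U"
  have E: "0 \<le> E" "N = E * U"
    using U nn by (auto simp: E_def)
  let ?X = "S - 2 * ((1 + \<alpha>) / U) * Q + ((1 + \<alpha>) / U)\<^sup>2 * N\<^sup>2"
  let ?Y = "(1 + \<alpha> + \<alpha>') * E + \<beta>' * P"
  let ?I = "4 / n * \<alpha> * \<beta>' * (\<alpha> + \<alpha>' + 1) + \<beta> * \<alpha> - 2 * q * \<beta> * \<alpha> + q * (q - 1 - \<alpha>) * \<beta>"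
  \<comment> \<open>The previous bound says that (1 + \<alpha>) E - L is at least \<open>?Y\<close>.
    Nonnegativity of \<open>?Y\<close> is what allows this to be squared and inserted into the trace
    inequality.\<close>
  have "0 \<le> ?Y"
    using E nn by simp
  moreover have "?Y \<le> - (L - (1 + \<alpha>) * E)"
    using bd by (simp add: algebra_simps flip: E_def)
  ultimately have "?Y\<^sup>2 \<le> (- (L - (1 + \<alpha>) * E))\<^sup>2"
    by (intro power_mono)
  then have "?Y\<^sup>2 \<le> (L - (1 + \<alpha>) * E)\<^sup>2"
    by (simp only: power2_minus)
  then have "?Y\<^sup>2 \<le> n * ?X"
    using X by (simp add: E_def)
  then have "?Y\<^sup>2 / n \<le> ?X"
    using n by (simp add: field_simps)
  then have h1: "0 \<le> 2 * \<alpha> / U * (?X - ?Y\<^sup>2 / n)"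
    using nn U by simp
  have h2: "0 \<le> E\<^sup>2 / U * (\<alpha> * ((2 / n) * (1 + \<alpha> + \<alpha>')\<^sup>2 - 2 * \<alpha>\<^sup>2 - \<alpha>))"
    using c1 U by simp
  have h3: "0 \<le> P\<^sup>2 / U * (1 + (2 * \<alpha> / n) * \<beta>'\<^sup>2 - q * \<beta>\<^sup>2)"
    using c2 U by simp
  have nonneg: "y \<le> x" if "x - y = a + b + c + d" "0 \<le> a" "0 \<le> b" "0 \<le> c" "0 \<le> d"
    for x y a b c d :: real
    using that by linarith
  have "(P\<^sup>2 / U + \<alpha> * ((2 * gl + 2 * S) / U - 4 * Q / U\<^sup>2 + 2 * N\<^sup>2 / U^3 - N * L / U\<^sup>2)
      + \<beta> * (Lf * T + 2 * q * T * D / U + P * (q * (q - 1) * N / U\<^sup>2 + q * L / U)))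
    - (2 * \<alpha> / U * (gl + \<alpha> * (2 * Q / U - N\<^sup>2 / U\<^sup>2) + \<beta> * (T * D + P * q * N / U))
      + (- \<alpha> * (N / U) + q * \<beta> * P) / U * (L + \<alpha> * (N / U) + \<beta> * P))
    = 2 * \<alpha> / U * (?X - ?Y\<^sup>2 / n) + E\<^sup>2 / U * (\<alpha> * ((2 / n) * (1 + \<alpha> + \<alpha>')\<^sup>2 - 2 * \<alpha>\<^sup>2 - \<alpha>))
      + P\<^sup>2 / U * (1 + (2 * \<alpha> / n) * \<beta>'\<^sup>2 - q * \<beta>\<^sup>2)
      + (\<beta> * (T * Lf + 2 * (q - \<alpha>) * T * D / U) + ?I * P * N / U\<^sup>2)"
    unfolding E(2) using U n
    by (simp add: divide_simps power2_eq_square power3_eq_cube) (simp add: algebra_simps)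
  then show ?thesis
    using h1 h2 h3 quad by (rule nonneg)
qed


text \<open>Everything assumed about the weight \<open>f\<close> concerns its jet and value at the
  single point \<open>x\<close>. This allows \<open>f\<close> to be a minorant of |y|^b touching it
  at \<open>x\<close>, and \<beta> = 0 gives the version used for strictness at the origin.\<close>

lemma differential_inequality:
  fixes u f :: "real ^ 'n::finite \<Rightarrow> real"
  defines "w \<equiv> \<lambda>\<alpha> \<beta> q y. laplacian u y + \<alpha> * grad_energy u y + \<beta> * (f y * u y powr q)"
  assumes C: "C_k 4 u" and pos: "u x > 0" and Jf: "has_jet2 f x gf Lf" and f0: "f x \<ge> 0"
    and eq: "laplacian (laplacian u) x = (f x)\<^sup>2 * u x powr (2 * q - 1)"
    and bd: "laplacian u x \<le> - \<alpha>' * grad_energy u x - \<beta>' * (f x * u x powr q)"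
    and nn: "0 \<le> \<alpha>" "0 \<le> \<alpha>'" "0 \<le> \<beta>'"
    and c1: "0 \<le> \<alpha> * ((2 / real CARD('n)) * (1 + \<alpha> + \<alpha>')\<^sup>2 - 2 * \<alpha>\<^sup>2 - \<alpha>)"
    and c2: "q * \<beta>\<^sup>2 \<le> 1 + (2 * \<alpha> / real CARD('n)) * \<beta>'\<^sup>2"
    and quad: "0 \<le> \<beta> * (u x powr q * Lf + 2 * (q - \<alpha>) * u x powr q * (grad u x \<bullet> gf) / u x)
      + (4 / real CARD('n) * \<alpha> * \<beta>' * (\<alpha> + \<alpha>' + 1) + \<beta> * \<alpha> - 2 * q * \<beta> * \<alpha> + q * (q - 1 - \<alpha>) * \<beta>)
        * (f x * u x powr q) * (grad u x \<bullet> grad u x) / (u x)\<^sup>2"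
  obtains G M where "has_jet2 (w \<alpha> \<beta> q) x G M"
    "2 * \<alpha> / u x * (grad u x \<bullet> G)
      + (- \<alpha> * grad_energy u x + q * \<beta> * (f x * u x powr q)) / u x * w \<alpha> \<beta> q x \<le> M"
proof -
  have C4: "C_k (Suc (Suc (Suc (Suc 0)))) u"
    using C by (simp add: numeral_eq_Suc)
  then have C3: "C_k (Suc (Suc (Suc 0))) u" and C2: "C_k (Suc (Suc 0)) u"
    using C_k_SucD by blast+
  let ?U = "u x" and ?T = "u x powr q" and ?g = "grad u x" and ?L = "laplacian u x"
  let ?N = "?g \<bullet> ?g" and ?P = "f x * u x powr q" and ?gl = "grad (laplacian u) x"
  let ?H = "\<lambda>j. grad (partial_deriv j u) x"
  let ?S = "\<Sum>j\<in>UNIV. ?H j \<bullet> ?H j" and ?Q = "\<Sum>j\<in>UNIV. ?g $ j * (?H j \<bullet> ?g)"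
  let ?GH = "\<Sum>j\<in>UNIV. ?g $ j *\<^sub>R ?H j"
  define GE where "GE = (2 / ?U) *\<^sub>R ?GH - (?N / ?U\<^sup>2) *\<^sub>R ?g"
  define LE where "LE = (2 * (?g \<bullet> ?gl) + 2 * ?S) / ?U - 4 * ?Q / ?U\<^sup>2 + 2 * ?N\<^sup>2 / ?U^3 - ?N * ?L / ?U\<^sup>2"
  have T1: "?U powr (q - 1) = ?T / ?U" and T2: "?U powr (q - 2) = ?T / ?U\<^sup>2"
    and T3: "?U powr (2 * q - 1) = ?T\<^sup>2 / ?U"
    using pos by (simp_all add: powr_diff powr_add[symmetric] power2_eq_square)
  have JE: "has_jet2 (grad_energy u) x GE LE"
    unfolding GE_def LE_def by (rule has_jet2_grad_energy[OF C3 pos])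
  have JL: "has_jet2 (laplacian u) x ?gl (laplacian (laplacian u) x)"
    by (rule has_jet2_grad[OF C_k_laplacian[OF C4]])
  have JP: "has_jet2 (\<lambda>y. f y * u y powr q) x (?T *\<^sub>R gf + f x *\<^sub>R (q * (?T / ?U)) *\<^sub>R ?g)
      (Lf * ?T + 2 * (gf \<bullet> ((q * (?T / ?U)) *\<^sub>R ?g))
        + f x * (q * (q - 1) * (?T / ?U\<^sup>2) * ?N + q * (?T / ?U) * ?L))"
    using has_jet2_mult[OF Jf has_jet2_powr[OF has_jet2_grad[OF C2] pos, of q]] unfolding T1 T2 .
  let ?G = "?gl + \<alpha> *\<^sub>R GE + \<beta> *\<^sub>R (?T *\<^sub>R gf + f x *\<^sub>R (q * (?T / ?U)) *\<^sub>R ?g)"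
  let ?M = "laplacian (laplacian u) x + \<alpha> * LE + \<beta> * (Lf * ?T + 2 * (gf \<bullet> ((q * (?T / ?U)) *\<^sub>R ?g))
        + f x * (q * (q - 1) * (?T / ?U\<^sup>2) * ?N + q * (?T / ?U) * ?L))"
  have J: "has_jet2 (w \<alpha> \<beta> q) x ?G ?M"
    unfolding w_def by (intro has_jet2_add has_jet2_scale JE JL JP)
  have tr: "(\<Sum>j\<in>UNIV. ?H j $ j) = ?L"
    by (simp add: grad_def laplacian_def)
  have X: "(?L - (1 + \<alpha>) * (?N / ?U))\<^sup>2
      \<le> real CARD('n) * (?S - 2 * ((1 + \<alpha>) / ?U) * ?Q + ((1 + \<alpha>) / ?U)\<^sup>2 * ?N\<^sup>2)"
    using trace_shift_sq_le[of ?H "(1 + \<alpha>) / ?U" ?g] unfolding tr by simp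
  have gGE: "?g \<bullet> GE = 2 * ?Q / ?U - ?N\<^sup>2 / ?U\<^sup>2"
    by (simp add: GE_def inner_simps inner_sum_right inner_commute power2_eq_square)
  have gG: "?g \<bullet> ?G = ?g \<bullet> ?gl + \<alpha> * (2 * ?Q / ?U - ?N\<^sup>2 / ?U\<^sup>2)
      + \<beta> * (?T * (?g \<bullet> gf) + ?P * q * ?N / ?U)"
    by (simp add: inner_simps gGE)
  have Meq: "?M = ?P\<^sup>2 / ?U + \<alpha> * LE
      + \<beta> * (Lf * ?T + 2 * q * ?T * (?g \<bullet> gf) / ?U + ?P * (q * (q - 1) * ?N / ?U\<^sup>2 + q * ?L / ?U))"
    unfolding eq T3 by (simp add: power_mult_distrib inner_commute algebra_simps)
  have "2 * \<alpha> / ?U * (?g \<bullet> ?G) + (- \<alpha> * (?N / ?U) + q * \<beta> * ?P) / ?U * (?L + \<alpha> * (?N / ?U) + \<beta> * ?P) \<le> ?M"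
    unfolding gG Meq unfolding LE_def
    by (rule differential_inequality_algebra[OF pos _ X bd[unfolded grad_energy_def] nn _ _ c1 c2])
      (use f0 quad in auto)
  then show ?thesis
    using that[OF J] by (simp add: w_def grad_energy_def)
qed

text \<open>The hypotheses on \<open>K\<close> say that \<open>(R\<^sup>2 - \<bar>y\<bar>\<^sup>2)\<^sup>2 w / sqrt u\<close> has a local maximum with value \<open>K\<close>
  at \<open>x\<close>, written so that no quotient has to be differentiated. With \<open>w / u\<^sup>s\<close> in place of
  \<open>w / sqrt u\<close> the energy term would have the factor \<open>s - s\<^sup>2 + (2 * s - 1) * \<alpha>\<close>, which for
  \<open>s = 1 / 2\<close> is positive and independent of \<open>\<alpha>\<close>.\<close>

lemma interior_maximum_bound:
  fixes u w :: "real ^ 'n::finite \<Rightarrow> real"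
  assumes C: "C_k (Suc (Suc k)) u" and pos: "u x > 0" and Jw: "has_jet2 w x G M" and wpos: "w x > 0"
    and \<psi>: "x \<bullet> x < R\<^sup>2" and \<alpha>: "0 \<le> \<alpha>"
    and max: "\<forall>\<^sub>F y in nhds x. w y \<le> K * (u y powr (1/2) * (R\<^sup>2 - y \<bullet> y) powr (-2))"
    and max_eq: "w x = K * (u x powr (1/2) * (R\<^sup>2 - x \<bullet> x) powr (-2))"
    and L: "laplacian u x \<le> 0"
    and ineq: "2 * \<alpha> / u x * (grad u x \<bullet> G) + (- \<alpha> * grad_energy u x + q * F) / u x * w x \<le> M"
  shows "q * F / u x + grad_energy u x / (8 * u x)
    \<le> (24 + 4 * real CARD('n) + 32 * (2 * \<alpha> - 1)\<^sup>2) * R\<^sup>2 / (R\<^sup>2 - x \<bullet> x)\<^sup>2"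
proof -
  let ?U = "u x" and ?g = "grad u x" and ?L = "laplacian u x" and ?n = "real CARD('n)"
  define \<psi>' where "\<psi>' = R\<^sup>2 - x \<bullet> x"
  let ?N = "?g \<bullet> ?g" and ?r = "x \<bullet> x" and ?X = "?g \<bullet> x"
  have p: "\<psi>' > 0"
    using \<psi> by (simp add: \<psi>'_def)
  define Z where "Z = ?U powr (1/2)"
  have Z: "Z > 0" "?U powr (1/2 - 1) = Z / ?U" "?U powr (1/2 - 2) = Z / ?U\<^sup>2"
    using pos unfolding Z_def by (simp_all only: powr_diff) (simp_all add: powr_gt_zero)
  define Y where "Y = \<psi>' powr (-2)"
  have Y: "Y > 0" "\<psi>' powr (-2 - 1) = Y / \<psi>'" "\<psi>' powr (-2 - 2) = Y / \<psi>'\<^sup>2"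
    using p unfolding Y_def by (simp_all only: powr_diff) (simp_all add: powr_gt_zero)
  have "has_jet2 (\<lambda>y. R\<^sup>2 + (-1) * (y \<bullet> y)) x (0 + (-1) *\<^sub>R 2 *\<^sub>R x) (0 + (-1) * (2 * ?n))"
    by (intro has_jet2_add has_jet2_const has_jet2_scale has_jet2_inner_self)
  then have "has_jet2 (\<lambda>y. R\<^sup>2 - y \<bullet> y) x (- (2 *\<^sub>R x)) (- (2 * ?n))"
    by simp
  from has_jet2_powr[OF this, of "-2", folded \<psi>'_def, OF p]
  have J\<psi>: "has_jet2 (\<lambda>y. (R\<^sup>2 - y \<bullet> y) powr (-2)) x ((4 * Y / \<psi>') *\<^sub>R x)
      (24 * Y / \<psi>'\<^sup>2 * ?r + 4 * ?n * Y / \<psi>')"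
    unfolding Y by (simp add: mult_ac)
  from has_jet2_powr[OF has_jet2_grad[OF C] pos, of "1/2"]
  have Ju: "has_jet2 (\<lambda>y. u y powr (1/2)) x ((Z / (2 * ?U)) *\<^sub>R ?g)
      (- (Z / (4 * ?U\<^sup>2) * ?N) + Z / (2 * ?U) * ?L)"
    unfolding Z by simp
  note J = has_jet2_scale[OF has_jet2_mult[OF Ju J\<psi>], of "-K", folded Z_def \<psi>'_def Y_def]
  let ?G2 = "Y *\<^sub>R (Z / (2 * ?U)) *\<^sub>R ?g + Z *\<^sub>R (4 * Y / \<psi>') *\<^sub>R x"
  let ?L2 = "(- (Z / (4 * ?U\<^sup>2) * ?N) + Z / (2 * ?U) * ?L) * Y
      + 2 * (((Z / (2 * ?U)) *\<^sub>R ?g) \<bullet> ((4 * Y / \<psi>') *\<^sub>R x)) + Z * (24 * Y / \<psi>'\<^sup>2 * ?r + 4 * ?n * Y / \<psi>')"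
  have "has_jet2 (\<lambda>y. w y + (-K) * (u y powr (1/2) * (R\<^sup>2 - y \<bullet> y) powr (-2))) x
      (G + (-K) *\<^sub>R ?G2) (M + (-K) * ?L2)"
    by (rule has_jet2_add[OF Jw J])
  moreover have "\<forall>\<^sub>F y in nhds x. w y + (-K) * (u y powr (1/2) * (R\<^sup>2 - y \<bullet> y) powr (-2))
      \<le> w x + (-K) * (u x powr (1/2) * (R\<^sup>2 - x \<bullet> x) powr (-2))"
    using max by eventually_elim (use max_eq in simp)
  ultimately have G: "G + (-K) *\<^sub>R ?G2 = 0" and M: "M + (-K) * ?L2 \<le> 0"
    by (rule has_jet2_local_max)+
  have W: "w x = K * (Z * Y)"
    using max_eq by (simp add: Z_def Y_def \<psi>'_def)
  have gG: "?g \<bullet> G = w x * (?N / (2 * ?U) + 4 * ?X / \<psi>')"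
  proof -
    have "G = K *\<^sub>R ?G2"
      using G by (simp add: add_eq_0_iff)
    then show ?thesis
      unfolding W by (simp add: inner_simps algebra_simps)
  qed
  have L2: "K * ?L2 = w x * (- (?N / (4 * ?U\<^sup>2)) + ?L / (2 * ?U) + 4 * ?X / (?U * \<psi>')
      + 24 * ?r / \<psi>'\<^sup>2 + 4 * ?n / \<psi>')"
    unfolding W using pos p by (simp add: field_simps)
  have "w x * (2 * \<alpha> / ?U * (?N / (2 * ?U) + 4 * ?X / \<psi>') + (- \<alpha> * (?N / ?U) + q * F) / ?U)
      \<le> w x * (- (?N / (4 * ?U\<^sup>2)) + ?L / (2 * ?U) + 4 * ?X / (?U * \<psi>') + 24 * ?r / \<psi>'\<^sup>2 + 4 * ?n / \<psi>')"
    using ineq M unfolding gG L2[symmetric] grad_energy_def by (simp add: algebra_simps)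
  then have "2 * \<alpha> / ?U * (?N / (2 * ?U) + 4 * ?X / \<psi>') + (- \<alpha> * (?N / ?U) + q * F) / ?U
      \<le> - (?N / (4 * ?U\<^sup>2)) + ?L / (2 * ?U) + 4 * ?X / (?U * \<psi>') + 24 * ?r / \<psi>'\<^sup>2 + 4 * ?n / \<psi>'"
    using wpos by simp
  \<comment> \<open>The critical point condition contributes \<alpha> N/U^2, which cancels the term
    of the wrong sign exactly. The good term N/(4 U^2) from the second derivative of the square root
    is left over.\<close>
  moreover have "2 * \<alpha> / ?U * (?N / (2 * ?U) + 4 * ?X / \<psi>') + (- \<alpha> * (?N / ?U) + q * F) / ?U
      = 4 * (2 * \<alpha>) * ?X / (?U * \<psi>') + q * F / ?U"
    using pos p by (simp add: field_simps power2_eq_square)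
  moreover have "?L / (2 * ?U) \<le> 0"
    using L pos by (simp add: divide_nonpos_pos)
  ultimately have main: "q * F / ?U + ?N / (4 * ?U\<^sup>2)
      \<le> - (4 * (2 * \<alpha> - 1) * ?X / (?U * \<psi>')) + 24 * ?r / \<psi>'\<^sup>2 + 4 * ?n / \<psi>'"
    by (simp add: algebra_simps diff_divide_distrib)
  have cs: "?X\<^sup>2 \<le> ?N * ?r"
    by (rule Cauchy_Schwarz_ineq)
  \<comment> \<open>Young's inequality, with constants chosen so that the drift created by the
    cutoff uses up only half of N/(4 U^2).\<close>
  have "- (4 * (2 * \<alpha> - 1) * ?X / (?U * \<psi>')) \<le> ?N / (8 * ?U\<^sup>2) + 32 * (2 * \<alpha> - 1)\<^sup>2 * ?r / \<psi>'\<^sup>2"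
  proof (cases "?r = 0")
    case True
    then show ?thesis by simp
  next
    case False
    then have r: "?r > 0" by simp
    define c where "c = 2 * \<alpha> - 1"
    have "0 \<le> (?X / (?U * sqrt ?r) + 16 * c * sqrt ?r / \<psi>')\<^sup>2"
      by simp
    also have "\<dots> = ?X\<^sup>2 / (?U\<^sup>2 * ?r) + 32 * c * ?X / (?U * \<psi>') + 256 * c\<^sup>2 * ?r / \<psi>'\<^sup>2"
      using r by (simp add: power2_sum power_mult_distrib power_divide)
    also have "?X\<^sup>2 / (?U\<^sup>2 * ?r) \<le> ?N / ?U\<^sup>2"
      using cs r pos by (simp add: field_simps)
    finally have "0 \<le> ?N / ?U\<^sup>2 + 32 * (c * ?X / (?U * \<psi>')) + 256 * (c\<^sup>2 * ?r / \<psi>'\<^sup>2)"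
      by (simp add: mult.assoc)
    moreover have "- (4 * y) \<le> a / 8 + 32 * z" if "0 \<le> a + 32 * y + 256 * z" for a y z :: real
      using that by linarith
    ultimately have "- (4 * (c * ?X / (?U * \<psi>'))) \<le> ?N / ?U\<^sup>2 / 8 + 32 * (c\<^sup>2 * ?r / \<psi>'\<^sup>2)"
      by blast
    then show ?thesis
      unfolding c_def[symmetric] by (simp add: mult_ac)
  qed
  moreover have "24 * ?r / \<psi>'\<^sup>2 + 4 * ?n / \<psi>' + 32 * (2 * \<alpha> - 1)\<^sup>2 * ?r / \<psi>'\<^sup>2
      \<le> (24 + 4 * ?n + 32 * (2 * \<alpha> - 1)\<^sup>2) * R\<^sup>2 / \<psi>'\<^sup>2"
  proof -
    have "?r \<le> R\<^sup>2" "\<psi>' \<le> R\<^sup>2"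
      using p by (simp_all add: \<psi>'_def)
    then have "24 * ?r + 4 * ?n * \<psi>' + 32 * (2 * \<alpha> - 1)\<^sup>2 * ?r
        \<le> 24 * R\<^sup>2 + 4 * ?n * R\<^sup>2 + 32 * (2 * \<alpha> - 1)\<^sup>2 * R\<^sup>2"
      by (intro add_mono mult_left_mono) auto
    then have "(24 * ?r + 4 * ?n * \<psi>' + 32 * (2 * \<alpha> - 1)\<^sup>2 * ?r) / \<psi>'\<^sup>2
        \<le> (24 + 4 * ?n + 32 * (2 * \<alpha> - 1)\<^sup>2) * R\<^sup>2 / \<psi>'\<^sup>2"
      by (intro divide_right_mono) (auto simp: algebra_simps)
    then show ?thesis
      using p by (simp add: add_divide_distrib power2_eq_square)
  qed
  ultimately have "q * F / ?U + ?N / (8 * ?U\<^sup>2) \<le> (24 + 4 * ?n + 32 * (2 * \<alpha> - 1)\<^sup>2) * R\<^sup>2 / \<psi>'\<^sup>2"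
    using main by simp
  then show ?thesis
    by (simp add: grad_energy_def \<psi>'_def power2_eq_square mult.assoc)
qed

section \<open>The iteration step\<close>

lemma norm_pow_nonneg: "norm_pow x a \<ge> 0"
  by (simp add: norm_pow_def)

lemma norm_pow_double: "norm_pow x (2 * b) = (norm_pow x b)\<^sup>2"
  by (simp add: norm_pow_def power2_eq_square powr_add[symmetric])

lemma continuous_on_norm_pow: "b \<ge> 0 \<Longrightarrow> continuous_on S (\<lambda>x. norm_pow x b)"
  by (cases "b = 0") (auto simp: norm_pow_def intro!: continuous_intros continuous_on_powr')

text \<open>At the origin the weight need not be twice differentiable, but there it can be replaced by
  its minorant 0, with which it agrees at that point.\<close>

lemma norm_pow_minorant:
  fixes x :: "real ^ 'n::finite"
  obtains f where "has_jet2 f x ((b * norm_pow x b / (x \<bullet> x)) *\<^sub>R x)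
      (b * (real CARD('n) - 2 + b) * norm_pow x b / (x \<bullet> x))"
    "f x = norm_pow x b" "\<And>y. f y \<le> norm_pow y b"
proof -
  consider "b = 0" | "b \<noteq> 0" "x = 0" | "b \<noteq> 0" "x \<noteq> 0"
    by blast
  then show thesis
  proof cases
    case 1
    show thesis
      by (rule that[of "\<lambda>y. 1"]) (use 1 has_jet2_const[of 1 x] in \<open>simp_all add: norm_pow_def\<close>)
  next
    case 2
    show thesis
      by (rule that[of "\<lambda>y. 0"]) (use 2 has_jet2_const[of 0 x] in \<open>simp_all add: norm_pow_def\<close>)
  next
    case 3
    show thesis
      by (rule that[of "\<lambda>y. norm y powr b"])
        (use 3(1) has_jet2_norm_powr[OF 3(2), of b] in \<open>simp_all add: norm_pow_def\<close>)
  qed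
qed

text \<open>By Cauchy-Schwarz, g . g is at least (g . x)^2/|x|^2. After the factor F T/|x|^2 is
  taken out, what remains is a quadratic polynomial in y = (g . x)/U, and \<open>cond\<close> is its
  discriminant condition. At x = 0 the quotients by \<open>x \<bullet> x\<close> are 0, in agreement
  with the jet of the minorant there.\<close>

lemma weight_quadratic_form_nonneg:
  fixes g x :: "real ^ 'n::finite"
  assumes nn: "0 \<le> \<beta>" "0 \<le> I" "0 \<le> b" "2 \<le> n" "0 < U" "0 \<le> F" "0 \<le> T"
    and cond: "b * \<beta> * (q - \<alpha>)\<^sup>2 \<le> (n - 2 + b) * I"
  shows "0 \<le> \<beta> * (T * (b * (n - 2 + b) * F / (x \<bullet> x))
      + 2 * (q - \<alpha>) * T * (g \<bullet> ((b * F / (x \<bullet> x)) *\<^sub>R x)) / U) + I * (F * T) * (g \<bullet> g) / U\<^sup>2"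
proof (cases "x = 0")
  case True
  then show ?thesis using nn by simp
next
  case False
  define r where "r = x \<bullet> x"
  define y where "y = (g \<bullet> x) / U"
  have r: "r > 0"
    using False by (simp add: r_def)
  \<comment> \<open>Completing the square requires dividing by \<open>I\<close>. If I = 0, the
    condition forces the linear term to vanish instead.\<close>
  have form: "0 \<le> \<beta> * b * (n - 2 + b) + 2 * \<beta> * (q - \<alpha>) * b * y + I * y\<^sup>2"
  proof (cases "I = 0")
    case True
    then have "b * \<beta> * (q - \<alpha>)\<^sup>2 \<le> 0"
      using cond by simp
    moreover have "0 \<le> b * \<beta> * (q - \<alpha>)\<^sup>2"
      using nn by simp
    ultimately have "b * \<beta> * (q - \<alpha>)\<^sup>2 = 0"
      by (rule antisym)
    then have Z: "2 * \<beta> * (q - \<alpha>) * b * y = 0"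
      by auto
    show ?thesis
      unfolding Z True using nn by simp
  next
    case False
    have "0 \<le> (I * y + \<beta> * (q - \<alpha>) * b)\<^sup>2 + \<beta> * b * ((n - 2 + b) * I - b * \<beta> * (q - \<alpha>)\<^sup>2)"
      using cond nn by simp
    also have "\<dots> = I * (\<beta> * b * (n - 2 + b) + 2 * \<beta> * (q - \<alpha>) * b * y + I * y\<^sup>2)"
      by (simp add: power2_eq_square algebra_simps)
    finally show ?thesis
      using False nn by (simp add: zero_le_mult_iff)
  qed
  have "(g \<bullet> x)\<^sup>2 \<le> (g \<bullet> g) * r"
    unfolding r_def by (rule Cauchy_Schwarz_ineq)
  then have "I * y\<^sup>2 / r \<le> I * (g \<bullet> g) / U\<^sup>2"
  proof -
    assume cs: "(g \<bullet> x)\<^sup>2 \<le> (g \<bullet> g) * r"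
    have "I * y\<^sup>2 / r = I / U\<^sup>2 * ((g \<bullet> x)\<^sup>2 / r)"
      by (simp add: y_def power_divide)
    also have "\<dots> \<le> I / U\<^sup>2 * (g \<bullet> g)"
      using cs r nn by (intro mult_left_mono) (simp_all add: divide_le_eq)
    finally show ?thesis
      by simp
  qed
  moreover have "0 \<le> (\<beta> * b * (n - 2 + b) + 2 * \<beta> * (q - \<alpha>) * b * y + I * y\<^sup>2) / r"
    using form r by simp
  ultimately have "0 \<le> (\<beta> * b * (n - 2 + b) + 2 * \<beta> * (q - \<alpha>) * b * y) / r + I * (g \<bullet> g) / U\<^sup>2"
    by (simp add: add_divide_distrib)
  then have "0 \<le> F * T * ((\<beta> * b * (n - 2 + b) + 2 * \<beta> * (q - \<alpha>) * b * y) / r + I * (g \<bullet> g) / U\<^sup>2)"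
    using nn by simp
  also have "\<dots> = \<beta> * (T * (b * (n - 2 + b) * F / (x \<bullet> x))
      + 2 * (q - \<alpha>) * T * (g \<bullet> ((b * F / (x \<bullet> x)) *\<^sub>R x)) / U) + I * (F * T) * (g \<bullet> g) / U\<^sup>2"
    unfolding r_def y_def by (simp add: divide_inverse algebra_simps)
  finally show ?thesis .
qed

lemma continuous_on_grad_energy:
  assumes "C_k 2 u" "\<And>x. u x > 0"
  shows "continuous_on S (grad_energy u)"
proof -
  have C: "C_k (Suc (Suc 0)) u"
    using assms(1) by (simp add: numeral_eq_Suc)
  then have "continuous_on UNIV u" "continuous_on UNIV (partial_deriv i u)" for i
    using C_k_continuous[OF C] C_k_continuous[of "Suc 0" "partial_deriv i u"] by simp_all
  then have "continuous_on S u" "continuous_on S (partial_deriv i u)" for i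
    using continuous_on_subset by blast+
  moreover have "u x \<noteq> 0" for x
    using assms(2)[of x] by simp
  ultimately show ?thesis
    unfolding grad_energy_def[abs_def] grad_def
    by (intro continuous_on_divide continuous_on_inner continuous_on_vec_lambda) auto
qed

text \<open>Put R^2 = s. For s >= 2r the left side is at least c s^2/4 when c > 0, and this exceeds
  D s as soon as s > 4D/c.\<close>

lemma quadratic_growth_nonpos:
  fixes c D r :: real
  assumes "0 \<le> r" "0 \<le> D" and bound: "\<And>R. 0 < R \<Longrightarrow> r < R\<^sup>2 \<Longrightarrow> c * (R\<^sup>2 - r)\<^sup>2 \<le> D * R\<^sup>2"
  shows "c \<le> 0"
proof (rule ccontr)
  assume "\<not> c \<le> 0"
  then have c: "c > 0" by simp
  define s where "s = 2 * r + 4 * D / c + 1"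
  have s: "s > 0" "2 * r \<le> s" "4 * D / c < s"
    using c assms by (auto simp: s_def add_nonneg_pos)
  then have "c * (s - r)\<^sup>2 \<le> D * s"
    using bound[of "sqrt s"] assms(1) by simp
  moreover have "(s / 2)\<^sup>2 \<le> (s - r)\<^sup>2"
    using s by (intro power_mono) auto
  then have "c * (s / 2)\<^sup>2 \<le> c * (s - r)\<^sup>2"
    using c by simp
  ultimately have "c * s * s \<le> 4 * D * s"
    by (simp add: power2_eq_square)
  then have "c * s \<le> 4 * D"
    using s by simp
  then show False
    using s c by (simp add: field_simps)
qed

text \<open>At the maximum point z of \<open>h\<close> the zeroth-order coefficient bounds w/u, so h
  z is at most a constant times R^2 sqrt(u z). The upper bound \<open>B\<close> for u removes the
  dependence on the unknown point z, and comparison with h x leaves a bound for w x whose right side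
  grows only like R^2 while the cutoff grows like R^4.\<close>

lemma pointwise_estimate_step:
  fixes u :: "real ^ 'n::finite \<Rightarrow> real"
  assumes C: "C_k 4 u" and pos: "\<And>x. u x > 0" and B: "\<And>x. u x \<le> B"
    and eq: "\<And>x. laplacian (laplacian u) x = norm_pow x (2 * b) * u x powr (2 * q - 1)"
    and bd: "\<And>x. laplacian u x \<le> - \<alpha>' * grad_energy u x - \<beta>' * (norm_pow x b * u x powr q)"
    and nn: "0 \<le> \<alpha>" "0 \<le> \<alpha>'" "0 \<le> \<beta>'" "0 \<le> \<beta>" "0 \<le> b" "1 \<le> q" "2 \<le> CARD('n)"
    and c1: "0 \<le> \<alpha> * ((2 / real CARD('n)) * (1 + \<alpha> + \<alpha>')\<^sup>2 - 2 * \<alpha>\<^sup>2 - \<alpha>)"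
    and c2: "q * \<beta>\<^sup>2 \<le> 1 + (2 * \<alpha> / real CARD('n)) * \<beta>'\<^sup>2"
    and I: "I = 4 / real CARD('n) * \<alpha> * \<beta>' * (\<alpha> + \<alpha>' + 1) + \<beta> * \<alpha> - 2 * q * \<beta> * \<alpha> + q * (q - 1 - \<alpha>) * \<beta>"
      "0 \<le> I" "b * \<beta> * (q - \<alpha>)\<^sup>2 \<le> (real CARD('n) - 2 + b) * I"
  shows "laplacian u x \<le> - \<alpha> * grad_energy u x - \<beta> * (norm_pow x b * u x powr q)"
proof -
  define w where "w y = laplacian u y + \<alpha> * grad_energy u y + \<beta> * (norm_pow y b * u y powr q)" for y
  have C4: "C_k (Suc (Suc (Suc (Suc 0)))) u"
    using C by (simp add: numeral_eq_Suc)
  then have C2: "C_k (Suc (Suc 0)) u"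
    using C_k_SucD by blast
  have C2': "C_k 2 u"
    using C2 by (simp add: numeral_eq_Suc)
  have u0: "u y \<noteq> 0" for y
    using pos[of y] by simp
  have E0: "grad_energy u y \<ge> 0" for y
    using pos[of y] by (simp add: grad_energy_def)
  have F0: "norm_pow y b * u y powr q \<ge> 0" for y
    by (simp add: norm_pow_nonneg)
  have L0: "laplacian u y \<le> 0" for y
    using bd[of y] mult_nonneg_nonneg[OF nn(2) E0[of y]] mult_nonneg_nonneg[OF nn(3) F0[of y]]
    by simp
  have cu: "continuous_on S u" for S
    using C_k_continuous[OF C2] continuous_on_subset by blast
  have cL: "continuous_on S (laplacian u)" for S
    using C_k_continuous[OF C_k_laplacian[OF C4]] continuous_on_subset by blast
  have cw: "continuous_on S w" for S
    unfolding w_def[abs_def]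
    by (intro continuous_on_add continuous_on_mult continuous_on_const continuous_on_powr cL cu
        continuous_on_grad_energy[OF C2' pos] continuous_on_norm_pow nn ballI u0)
  define C0 where "C0 = 24 + 4 * real CARD('n) + 32 * (2 * \<alpha> - 1)\<^sup>2"
  have C0: "C0 \<ge> 0"
    by (simp add: C0_def)
  have B0: "B > 0"
    using pos[of x] B[of x] by simp
  \<comment> \<open>\<open>D\<close> may depend on the fixed point \<open>x\<close> but not on R.
    The factor sqrt(u x) arises from clearing the denominator of h x.\<close>
  define D where "D = (8 * \<alpha> + 1) * C0 * sqrt B * sqrt (u x)"
  have D0: "D \<ge> 0"
    using C0 B0 nn pos[of x] by (simp add: D_def)
  have "w x * (R\<^sup>2 - x \<bullet> x)\<^sup>2 \<le> D * R\<^sup>2" if R: "0 < R" "x \<bullet> x < R\<^sup>2" for R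
  proof (cases "w x \<le> 0")
    case True
    then have "w x * (R\<^sup>2 - x \<bullet> x)\<^sup>2 \<le> 0"
      by (simp add: mult_nonpos_nonneg)
    also have "0 \<le> D * R\<^sup>2"
      using D0 by simp
    finally show ?thesis .
  next
    case False
    then have wx: "w x > 0" by simp
    have in_ball: "y \<in> cball 0 R \<longleftrightarrow> y \<bullet> y \<le> R\<^sup>2" for y :: "real^'n"
      using R(1) by (simp add: norm_le_square)
    define h where "h y = w y * (R\<^sup>2 - y \<bullet> y)\<^sup>2 / sqrt (u y)" for y
    have "continuous_on (cball 0 R) h"
      unfolding h_def[abs_def]
      by (intro continuous_on_divide continuous_on_mult continuous_on_power continuous_on_diff
          continuous_on_inner continuous_on_real_sqrt continuous_on_const continuous_on_id cw cu)
        (simp add: u0)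
    then obtain z where z: "z \<in> cball 0 R" "\<And>y. y \<in> cball 0 R \<Longrightarrow> h y \<le> h z"
      using continuous_attains_sup[of "cball 0 R" h] R(1) by auto
    have "h x > 0"
      using wx R pos[of x] by (simp add: h_def)
    then have hz: "h z > 0" and hxz: "h x \<le> h z"
      using z(2)[of x] R(2) in_ball[of x] by auto
    \<comment> \<open>The cutoff vanishes on the sphere, while h z >= h x > 0; hence the maximum is
      interior.\<close>
    have "R\<^sup>2 - z \<bullet> z \<noteq> 0"
      using hz by (auto simp: h_def)
    then have \<psi>: "z \<bullet> z < R\<^sup>2"
      using z(1) in_ball[of z] by simp
    have wz: "w z > 0"
      using hz \<psi> pos[of z] by (simp add: h_def zero_less_divide_iff zero_less_mult_iff not_less_iff_gr_or_eq)
    obtain f where Jf: "has_jet2 f z ((b * norm_pow z b / (z \<bullet> z)) *\<^sub>R z)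
        (b * (real CARD('n) - 2 + b) * norm_pow z b / (z \<bullet> z))"
      and fz: "f z = norm_pow z b" and fle: "\<And>y. f y \<le> norm_pow y b"
      by (rule norm_pow_minorant[of z b]) blast
    define v where "v y = laplacian u y + \<alpha> * grad_energy u y + \<beta> * (f y * u y powr q)" for y
    \<comment> \<open>Since \<beta> >= 0, \<open>v\<close> touches \<open>w\<close> from below at
      \<open>z\<close>. It therefore inherits the upper bound by the barrier with equality at
      \<open>z\<close>, and it has a jet there even if z = 0.\<close>
    have vw: "v y \<le> w y" for y
      using fle[of y] nn(4) by (simp add: v_def w_def mult_left_mono mult_right_mono)
    have vz: "v z = w z"
      by (simp add: v_def w_def fz)
    obtain G M where GM: "has_jet2 v z G M"
      "2 * \<alpha> / u z * (grad u z \<bullet> G)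
        + (- \<alpha> * grad_energy u z + q * \<beta> * (f z * u z powr q)) / u z * v z \<le> M"
    proof (rule differential_inequality[OF C pos[of z] Jf _ _ _ nn(1-3) c1 c2])
      show "f z \<ge> 0"
        by (simp add: fz norm_pow_nonneg)
      show "laplacian (laplacian u) z = (f z)\<^sup>2 * u z powr (2 * q - 1)"
        by (simp add: eq norm_pow_double fz)
      show "laplacian u z \<le> - \<alpha>' * grad_energy u z - \<beta>' * (f z * u z powr q)"
        using bd by (simp add: fz)
      show "0 \<le> \<beta> * (u z powr q * (b * (real CARD('n) - 2 + b) * norm_pow z b / (z \<bullet> z))
          + 2 * (q - \<alpha>) * u z powr q * (grad u z \<bullet> ((b * norm_pow z b / (z \<bullet> z)) *\<^sub>R z)) / u z)
        + (4 / real CARD('n) * \<alpha> * \<beta>' * (\<alpha> + \<alpha>' + 1) + \<beta> * \<alpha> - 2 * q * \<beta> * \<alpha> + q * (q - 1 - \<alpha>) * \<beta>)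
          * (f z * u z powr q) * (grad u z \<bullet> grad u z) / (u z)\<^sup>2"
        unfolding fz I(1)[symmetric] using nn(7)
        by (intro weight_quadratic_form_nonneg nn I pos norm_pow_nonneg) auto
    qed (auto simp: v_def[abs_def])
    have ev: "\<forall>\<^sub>F y in nhds z. y \<bullet> y < R\<^sup>2"
    proof -
      have "((\<lambda>y. y \<bullet> y) \<longlongrightarrow> z \<bullet> z) (nhds z)"
        by (intro tendsto_intros filterlim_ident)
      then show ?thesis
        using \<psi> by (rule order_tendstoD(2))
    qed
    have powers: "(u y) powr (1/2) = sqrt (u y)" "(R\<^sup>2 - y \<bullet> y) powr (-2) = 1 / (R\<^sup>2 - y \<bullet> y)\<^sup>2"
      if "y \<bullet> y < R\<^sup>2" for y
      using that pos[of y] by (simp_all add: powr_half_sqrt powr_minus_divide)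
    have v_le: "\<forall>\<^sub>F y in nhds z. v y \<le> h z * (u y powr (1/2) * (R\<^sup>2 - y \<bullet> y) powr (-2))"
      using ev
    proof eventually_elim
      case (elim y)
      have "w y * (R\<^sup>2 - y \<bullet> y)\<^sup>2 / sqrt (u y) \<le> h z"
        using z(2)[of y] elim in_ball[of y] by (simp add: h_def)
      then have "w y \<le> h z * (sqrt (u y) * (1 / (R\<^sup>2 - y \<bullet> y)\<^sup>2))"
        using elim pos[of y] by (simp add: field_simps)
      then show ?case
        using vw[of y] by (simp add: powers[OF elim])
    qed
    have v_eq: "v z = h z * (u z powr (1/2) * (R\<^sup>2 - z \<bullet> z) powr (-2))"
      using \<psi> pos[of z] by (simp add: powers[OF \<psi>] h_def vz)
    have v_pos: "v z > 0"
      using wz vz by simp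
    have ineq: "2 * \<alpha> / u z * (grad u z \<bullet> G)
        + (- \<alpha> * grad_energy u z + q * (\<beta> * (f z * u z powr q))) / u z * v z \<le> M"
      using GM(2) by (simp add: mult.assoc)
    have est: "q * (\<beta> * (f z * u z powr q)) / u z + grad_energy u z / (8 * u z)
        \<le> C0 * R\<^sup>2 / (R\<^sup>2 - z \<bullet> z)\<^sup>2"
      unfolding C0_def
      by (rule interior_maximum_bound[OF C2 pos GM(1) v_pos \<psi> nn(1) v_le v_eq L0 ineq])
    let ?F = "\<beta> * (norm_pow z b * u z powr q)" and ?E = "grad_energy u z"
    have F: "?F \<ge> 0"
      using nn(4) F0[of z] by simp
    have "w z \<le> \<alpha> * ?E + ?F"
      using L0[of z] by (simp add: w_def)
    \<comment> \<open>The factor serves both terms: \<alpha> E is 8 \<alpha> times E/8, and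
      \<open>?F\<close> is at most q times itself because q >= 1.\<close>
    also have "\<dots> \<le> (8 * \<alpha> + 1) * (q * ?F + ?E / 8)"
    proof -
      have "?F \<le> q * ?F"
        using F nn(6) mult_right_mono[of 1 q ?F] by simp
      moreover have "0 \<le> 8 * \<alpha> * (q * ?F)"
        using F nn by simp
      moreover have "\<alpha> * e + y \<le> (8 * \<alpha> + 1) * (y' + e / 8)"
        if "y \<le> y'" "0 \<le> 8 * \<alpha> * y'" "0 \<le> e" for e y y' :: real
        using that by (simp add: algebra_simps)
      ultimately show ?thesis
        using E0[of z] by blast
    qed
    also have "q * ?F + ?E / 8 \<le> u z * (C0 * R\<^sup>2 / (R\<^sup>2 - z \<bullet> z)\<^sup>2)"
    proof -
      have "u z * (q * ?F / u z + ?E / (8 * u z)) = q * ?F + ?E / 8"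
        using pos[of z] by (simp add: field_simps)
      then show ?thesis
        using mult_left_mono[OF est, of "u z"] pos[of z] by (simp add: fz)
    qed
    finally have "w z \<le> (8 * \<alpha> + 1) * (u z * (C0 * R\<^sup>2 / (R\<^sup>2 - z \<bullet> z)\<^sup>2))"
      using nn(1) by simp
    then have "w z * (R\<^sup>2 - z \<bullet> z)\<^sup>2 \<le> (8 * \<alpha> + 1) * C0 * R\<^sup>2 * u z"
      using \<psi> by (simp add: field_simps)
    then have "h z \<le> (8 * \<alpha> + 1) * C0 * R\<^sup>2 * u z / sqrt (u z)"
      unfolding h_def using pos[of z] by (intro divide_right_mono) auto
    also have "\<dots> = (8 * \<alpha> + 1) * C0 * R\<^sup>2 * sqrt (u z)"
      using pos[of z] by (simp add: real_div_sqrt flip: times_divide_eq_right)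
    also have "\<dots> \<le> (8 * \<alpha> + 1) * C0 * R\<^sup>2 * sqrt B"
      using B[of z] nn C0 by (intro mult_left_mono) auto
    finally have "w x * (R\<^sup>2 - x \<bullet> x)\<^sup>2 / sqrt (u x) \<le> (8 * \<alpha> + 1) * C0 * R\<^sup>2 * sqrt B"
      using hxz by (simp add: h_def)
    then show ?thesis
      using pos[of x] by (simp add: D_def field_simps)
  qed
  then have "w x \<le> 0"
    using quadratic_growth_nonpos[of "x \<bullet> x" D "w x"] D0 by simp
  then show ?thesis
    by (simp add: w_def)
qed

section \<open>Superharmonicity\<close>

text \<open>A box, because differentiation under the integral is applied on boxes. Half-width 2
  leaves room to translate the unit ball by up to 1 in a coordinate direction.\<close>

definition big_cube :: "(real ^ 'n::finite) set" where
  "big_cube = cbox (- (\<chi> i. 2)) (\<chi> i. 2)"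

text \<open>For |t| <= 1 the translate of \<open>F\<close> by t is still supported in the cube, so
  its integral does not depend on t. Differentiating at t = 0 under the integral gives the claim,
  which serves as integration by parts.\<close>

lemma integral_partial_deriv_eq_0:
  fixes F :: "real ^ 'n::finite \<Rightarrow> real"
  assumes zero: "\<And>y. norm y > 1 \<Longrightarrow> F y = 0"
    and der: "\<And>y t. ((\<lambda>t. F (y + t *\<^sub>R axis i 1)) has_real_derivative F' (y + t *\<^sub>R axis i 1)) (at t)"
    and cF: "continuous_on UNIV F" and cF': "continuous_on UNIV F'"
  shows "integral big_cube F' = 0"
proof -
  let ?e = "axis i 1 :: real^'n"
  have const: "integral big_cube (\<lambda>y. F (y + t *\<^sub>R ?e)) = integral (cball 0 1) F"
    if t: "\<bar>t\<bar> \<le> 1" for t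
  proof -
    let ?A = "cbox (- (\<chi> i. 2) + t *\<^sub>R ?e) ((\<chi> i. 2) + t *\<^sub>R ?e)"
    have "integral big_cube (\<lambda>y. F (y + t *\<^sub>R ?e)) = integral ?A F"
      using integral_shift_cbox_plus[of "- (\<chi> i. 2)" "\<chi> i. 2" F "t *\<^sub>R ?e"]
      by (simp add: big_cube_def o_def add.commute)
    also have "\<dots> = integral ?A (\<lambda>y. if y \<in> cball 0 1 then F y else 0)"
      using zero by (intro integral_cong) auto
    also have "\<dots> = integral (cball 0 1 \<inter> ?A) F"
      by (rule Henstock_Kurzweil_Integration.integral_restrict_Int)
    also have "cball 0 1 \<inter> ?A = cball 0 1"
    proof (rule Int_absorb2, rule subsetI)
      fix y :: "real^'n"
      assume "y \<in> cball 0 1"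
      then have "\<bar>y $ j\<bar> \<le> 1" for j
        using component_le_norm_cart[of y j] by simp
      moreover have "\<bar>(t *\<^sub>R ?e) $ j\<bar> \<le> 1" for j
        using t by (simp add: axis_def)
      ultimately have "- 2 + (t *\<^sub>R ?e) $ j \<le> y $ j \<and> y $ j \<le> 2 + (t *\<^sub>R ?e) $ j" for j
        by (smt (verit))
      then show "y \<in> ?A"
        by (simp add: mem_box_cart)
    qed
    finally show ?thesis .
  qed
  have cont: "continuous_on S (\<lambda>(t, y). F' (y + t *\<^sub>R ?e))" for S
    unfolding split_beta by (intro continuous_on_compose2[OF cF'] continuous_intros) auto
  have cont1: "continuous_on S (\<lambda>y. F (y + t *\<^sub>R ?e))" for t S
    by (intro continuous_on_compose2[OF cF] continuous_intros) auto
  have "((\<lambda>t. integral big_cube (\<lambda>y. F (y + t *\<^sub>R ?e))) has_field_derivative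
      integral big_cube (\<lambda>y. F' (y + 0 *\<^sub>R ?e))) (at 0 within UNIV)"
    unfolding big_cube_def
    by (rule leibniz_rule_field_derivative)
      (auto intro!: der integrable_continuous cont cont1)
  then have 1: "((\<lambda>t. integral big_cube (\<lambda>y. F (y + t *\<^sub>R ?e))) has_real_derivative
      integral big_cube F') (at 0)"
    by simp
  have "((\<lambda>t. integral big_cube (\<lambda>y. F (y + t *\<^sub>R ?e))) has_real_derivative 0) (at 0)"
  proof (rule has_field_derivative_transform_within_open)
    show "((\<lambda>t::real. integral (cball 0 1) F) has_real_derivative 0) (at 0)"
      by simp
    show "open {-1<..<1::real}" by simp
  qed (auto simp: const)
  then show ?thesis
    using 1 DERIV_unique by blast
qed

section \<open>Averages over balls with the weight (1 - |y|^2)_+^m\<close>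

definition weight :: "nat \<Rightarrow> real ^ 'n::finite \<Rightarrow> real" where
  "weight m y = (max 0 (1 - y \<bullet> y)) ^ m"

lemma continuous_on_weight: "continuous_on S (weight m)"
  unfolding weight_def[abs_def] by (intro continuous_intros)

lemma weight_nonneg: "weight m y \<ge> 0"
  by (simp add: weight_def)

lemma weight_eq_0:
  assumes "norm y > 1" "0 < m"
  shows "weight m y = 0"
proof -
  have "1 - y \<bullet> y \<le> 0"
    using one_less_power[of "norm y" 2] assms(1) by (simp add: dot_square_norm)
  then have "max 0 (1 - y \<bullet> y) = 0"
    by (rule max_absorb1)
  then show ?thesis
    using assms(2) by (simp add: weight_def)
qed

text \<open>Only s = 0 is delicate: there the difference quotient is \<open>(max 0 z) ^ m\<close>,
  which is continuous and, as m > 0, vanishes at 0.\<close>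

lemma has_real_derivative_max_power:
  assumes "m > 0"
  shows "((\<lambda>s::real. (max 0 s) ^ Suc m) has_real_derivative real (Suc m) * (max 0 s) ^ m) (at s)"
proof -
  consider "s > 0" | "s < 0" | "s = 0" by linarith
  then show ?thesis
  proof cases
    case 1
    have "((\<lambda>s::real. s ^ Suc m) has_real_derivative real (Suc m) * s ^ m) (at s)"
      by (rule derivative_eq_intros) auto
    then have "((\<lambda>s::real. (max 0 s) ^ Suc m) has_real_derivative real (Suc m) * s ^ m) (at s)"
      by (rule has_field_derivative_transform_within_open[where S = "{0<..}"]) (use 1 in auto)
    then show ?thesis using 1 by simp
  next
    case 2
    have "((\<lambda>s::real. 0) has_real_derivative 0) (at s)"
      by simp
    then have "((\<lambda>s::real. (max 0 s) ^ Suc m) has_real_derivative 0) (at s)"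
      by (rule has_field_derivative_transform_within_open[where S = "{..<0}"]) (use 2 in auto)
    then show ?thesis
      by (rule DERIV_cong) (use 2 assms in simp)
  next
    case 3
    have "isCont (\<lambda>z::real. (max 0 z) ^ m) 0"
      by (intro continuous_intros)
    moreover have "\<forall>z::real. (max 0 z) ^ Suc m - (max 0 0) ^ Suc m = (max 0 z) ^ m * (z - 0)"
      using assms by (simp add: max_def)
    ultimately have "((\<lambda>s::real. (max 0 s) ^ Suc m) has_real_derivative 0) (at 0)"
      unfolding CARAT_DERIV using assms by (intro exI[of _ "\<lambda>z. (max 0 z) ^ m"]) simp
    then show ?thesis
      unfolding 3 by (rule DERIV_cong) (use assms in simp)
  qed
qed

lemma weight_line_derivative:
  assumes "m > 0"
  shows "((\<lambda>t. weight (Suc m) (y + t *\<^sub>R axis i 1)) has_real_derivative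
    - 2 * real (Suc m) * (y + t *\<^sub>R axis i 1) $ i * weight m (y + t *\<^sub>R axis i 1)) (at t)"
proof -
  let ?Y = "\<lambda>t. y + t *\<^sub>R axis i 1"
  have eq: "?Y t \<bullet> ?Y t = y \<bullet> y + 2 * t * y $ i + t\<^sup>2" for t
    by (simp add: inner_simps inner_axis inner_commute[of "axis i 1" y] power2_eq_square algebra_simps
        inner_axis_axis)
  have "((\<lambda>t. 1 - ?Y t \<bullet> ?Y t) has_real_derivative - 2 * ?Y t $ i) (at t)"
    unfolding eq by (auto intro!: derivative_eq_intros simp: axis_def)
  from DERIV_chain2[OF has_real_derivative_max_power[OF assms] this]
  show ?thesis
    unfolding weight_def by (rule DERIV_cong) (simp add: algebra_simps)
qed

text \<open>An unnormalised average over the ball of radius r about x, pulled back to the unit ball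
  so that r enters only through the integrand.\<close>

definition weighted_mean :: "nat \<Rightarrow> (real ^ 'n::finite \<Rightarrow> real) \<Rightarrow> real ^ 'n \<Rightarrow> real \<Rightarrow> real" where
  "weighted_mean m g x r = integral big_cube (\<lambda>y. g (x + r *\<^sub>R y) * weight m y)"

text \<open>The vector field y times the weight of order m is -1/(2(m+1)) times the gradient of the
  weight of order m + 1. Integrating the radial derivative by parts therefore produces the Laplacian
  and raises the order by one. This solid version of the mean value formula avoids surface
  integrals.\<close>

lemma weighted_mean_derivative:
  fixes g :: "real ^ 'n::finite \<Rightarrow> real"
  assumes C: "C_k 2 g" and m: "m > 0"
  shows "(weighted_mean m g x has_real_derivative
    r / (2 * real (Suc m)) * weighted_mean (Suc m) (laplacian g) x r) (at r)"
proof -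
  have C2: "C_k (Suc (Suc 0)) g"
    using C by (simp add: numeral_eq_Suc)
  have dg: "g differentiable at y" "partial_deriv i g differentiable at y" for y i
    using C2 by simp_all
  have cg: "continuous_on UNIV g" and cgi: "continuous_on UNIV (partial_deriv i g)"
    and cgii: "continuous_on UNIV (partial_deriv i (partial_deriv i g))" for i
    using C2 C_k_continuous[OF C2] C_k_continuous[of "Suc 0" "partial_deriv i g"] by simp_all
  note cs = continuous_on_compose2[OF cg] continuous_on_compose2[OF cgi] continuous_on_compose2[OF cgii]
    continuous_on_compose2[OF continuous_on_weight[of UNIV]]
  have line: "((\<lambda>r. g (x + r *\<^sub>R y)) has_real_derivative
      (\<Sum>i\<in>UNIV. y $ i * partial_deriv i g (x + r *\<^sub>R y))) (at r)" for r and y :: "real^'n"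
  proof -
    have "((\<lambda>r. x + r *\<^sub>R y) has_derivative (\<lambda>h. h *\<^sub>R y)) (at r)"
      by (auto intro!: derivative_eq_intros)
    from has_derivative_compose[OF this has_derivative_partial_deriv[OF dg(1)]]
    have "((\<lambda>r. g (x + r *\<^sub>R y)) has_derivative
        (\<lambda>h. \<Sum>i\<in>UNIV. (h *\<^sub>R y) $ i * partial_deriv i g (x + r *\<^sub>R y))) (at r)" .
    moreover have "(\<lambda>h. \<Sum>i\<in>UNIV. (h *\<^sub>R y) $ i * partial_deriv i g (x + r *\<^sub>R y))
        = (*) (\<Sum>i\<in>UNIV. y $ i * partial_deriv i g (x + r *\<^sub>R y))"
      by (simp add: fun_eq_iff sum_distrib_left sum_distrib_right mult_ac)
    ultimately show ?thesis
      by (simp add: has_field_derivative_def)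
  qed
  let ?d = "\<lambda>i (y::real^'n). y $ i * partial_deriv i g (x + r *\<^sub>R y) * weight m y"
  let ?dd = "\<lambda>i (y::real^'n). partial_deriv i (partial_deriv i g) (x + r *\<^sub>R y) * weight (Suc m) y"
  have int_d: "?d i integrable_on big_cube" and int_dd: "?dd i integrable_on big_cube" for i
    unfolding big_cube_def
    by (intro integrable_continuous continuous_intros cs continuous_on_weight; simp)+
  have "(weighted_mean m g x has_field_derivative
      integral big_cube (\<lambda>y::real^'n. (\<Sum>i\<in>UNIV. y $ i * partial_deriv i g (x + r *\<^sub>R y)) * weight m y))
      (at r within UNIV)"
    unfolding weighted_mean_def[abs_def] big_cube_def
  proof (rule leibniz_rule_field_derivative)
    fix s and y :: "real^'n"
    show "((\<lambda>r. g (x + r *\<^sub>R y) * weight m y) has_field_derivative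
        (\<Sum>i\<in>UNIV. y $ i * partial_deriv i g (x + s *\<^sub>R y)) * weight m y) (at s within UNIV)"
      using DERIV_cmult_right[OF line[of y s], of "weight m y"] by simp
    show "(\<lambda>y. g (x + s *\<^sub>R y) * weight m y) integrable_on cbox (- (\<chi> i. 2)) (\<chi> i. 2)"
      by (intro integrable_continuous continuous_intros cs continuous_on_weight) simp
  next
    show "continuous_on (UNIV \<times> cbox (- (\<chi> i. 2)) (\<chi> i. 2))
        (\<lambda>(r, y::real^'n). (\<Sum>i\<in>UNIV. y $ i * partial_deriv i g (x + r *\<^sub>R y)) * weight m y)"
      unfolding split_beta by (intro continuous_intros cs) auto
  qed auto
  moreover have "integral big_cube (\<lambda>y::real^'n. (\<Sum>i\<in>UNIV. y $ i * partial_deriv i g (x + r *\<^sub>R y)) * weight m y)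
      = (\<Sum>i\<in>UNIV. integral big_cube (?d i))"
    unfolding sum_distrib_right by (rule integral_sum) (auto intro: int_d)
  moreover have "2 * real (Suc m) * integral big_cube (?d i) = r * integral big_cube (?dd i)" for i
  proof -
    let ?F = "\<lambda>y::real^'n. partial_deriv i g (x + r *\<^sub>R y) * weight (Suc m) y"
    let ?F' = "\<lambda>y::real^'n. r * ?dd i y - 2 * real (Suc m) * ?d i y"
    have "integral big_cube ?F' = 0"
    proof (rule integral_partial_deriv_eq_0[where F = ?F and i = i])
      show "?F y = 0" if "norm y > 1" for y
        using weight_eq_0[OF that, of "Suc m"] by simp
      show "continuous_on UNIV ?F" "continuous_on UNIV ?F'"
        by (intro continuous_intros cs continuous_on_weight; simp)+
      fix y :: "real^'n" and t
      let ?Y = "\<lambda>t. y + t *\<^sub>R axis i 1"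
      have "((\<lambda>s. partial_deriv i g (x + r *\<^sub>R y + s *\<^sub>R axis i 1)) has_real_derivative
          partial_deriv i (partial_deriv i g) (x + r *\<^sub>R y + (r * t) *\<^sub>R axis i 1)) (at (r * t))"
        by (rule partial_deriv_has_derivative[OF dg(2)])
      moreover have "((\<lambda>t. r * t) has_real_derivative r) (at t)"
        by (auto intro!: derivative_eq_intros)
      ultimately have "((\<lambda>t. partial_deriv i g (x + r *\<^sub>R y + (r * t) *\<^sub>R axis i 1)) has_real_derivative
          partial_deriv i (partial_deriv i g) (x + r *\<^sub>R y + (r * t) *\<^sub>R axis i 1) * r) (at t)"
        by (rule DERIV_chain2)
      then have "((\<lambda>t. partial_deriv i g (x + r *\<^sub>R ?Y t)) has_real_derivative
          partial_deriv i (partial_deriv i g) (x + r *\<^sub>R ?Y t) * r) (at t)"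
        by (simp add: scaleR_add_right add.assoc)
      from DERIV_mult[OF this weight_line_derivative[OF m, of y i t]]
      show "((\<lambda>t. ?F (?Y t)) has_real_derivative ?F' (?Y t)) (at t)"
        by (rule DERIV_cong) (simp add: algebra_simps)
    qed
    moreover have "integral big_cube ?F' = r * integral big_cube (?dd i) - 2 * real (Suc m) * integral big_cube (?d i)"
      using integral_diff[OF integrable_on_mult_right[OF int_dd, of r] integrable_on_mult_right[OF int_d, of "2 * real (Suc m)"]]
      by (simp only: integral_mult_right)
    ultimately show ?thesis
      by simp
  qed
  then have "(\<Sum>i\<in>UNIV. integral big_cube (?d i)) = r / (2 * real (Suc m)) * (\<Sum>i\<in>UNIV. integral big_cube (?dd i))"
    unfolding sum_distrib_left by (intro sum.cong refl) (simp add: field_simps)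
  moreover have "(\<Sum>i\<in>UNIV. integral big_cube (?dd i)) = weighted_mean (Suc m) (laplacian g) x r"
    unfolding weighted_mean_def laplacian_def sum_distrib_right
    by (rule integral_sum[symmetric]) (auto intro: int_dd)
  ultimately show ?thesis
    by simp
qed

lemma weight_integrable: "weight m integrable_on (big_cube :: (real^'n::finite) set)"
  unfolding big_cube_def by (intro integrable_continuous continuous_on_weight)

lemma integral_weight_pos: "integral big_cube (weight m :: real^'n::finite \<Rightarrow> real) > 0"
proof -
  let ?w = "weight m :: real^'n \<Rightarrow> real"
  have "integral big_cube ?w \<ge> 0"
    by (intro integral_nonneg weight_integrable weight_nonneg)
  moreover have "integral big_cube ?w \<noteq> 0"
  proof
    assume "integral big_cube ?w = 0"
    then have "(?w has_integral 0) big_cube"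
      using weight_integrable integrable_integral by metis
    moreover have "box (- (\<chi> i. 2)) (\<chi> i. 2) \<noteq> ({} :: (real^'n) set)"
      and "0 \<in> cbox (- (\<chi> i. 2)) ((\<chi> i. 2) :: real^'n)"
      by (auto simp: mem_box_cart interval_ne_empty_cart)
    ultimately have "?w 0 = 0"
      unfolding big_cube_def
      by (intro has_integral_0_cbox_imp_0[OF continuous_on_weight weight_nonneg])
    then show False
      by (simp add: weight_def)
  qed
  ultimately show ?thesis by simp
qed

lemma laplacian_nonpos_of_bounded_bilaplacian_nonneg:
  fixes u :: "real ^ 'n::finite \<Rightarrow> real"
  assumes C: "C_k 4 u" and u: "\<And>x. 0 < u x" "\<And>x. u x \<le> B"
    and bi: "\<And>x. 0 \<le> laplacian (laplacian u) x"
  shows "laplacian u x \<le> 0"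
proof (rule ccontr)
  assume "\<not> laplacian u x \<le> 0"
  then have L: "laplacian u x > 0" by simp
  have C4: "C_k (Suc (Suc (Suc (Suc 0)))) u"
    using C by (simp add: numeral_eq_Suc)
  have C2: "C_k 2 u" and CL: "C_k 2 (laplacian u)"
    using C_k_laplacian[OF C4] C_k_SucD[OF C_k_SucD[OF C4]] by (simp_all add: numeral_eq_Suc)
  have cu: "continuous_on UNIV u"
    using C_k_continuous[OF C2] .
  \<comment> \<open>Each differentiation raises the order of the weight by one, and the formula
    requires a positive order; so u, its Laplacian and its bilaplacian are averaged with orders 1, 2
    and 3.\<close>
  define S where "S = weighted_mean 2 (laplacian u) x"
  define T where "T = weighted_mean 1 u x"
  define c where "c = laplacian u x * integral big_cube (weight 2 :: real^'n \<Rightarrow> real)"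
  have c: "c > 0"
    unfolding c_def by (rule mult_pos_pos[OF L integral_weight_pos])
  have dS: "(S has_real_derivative r / 6 * weighted_mean 3 (laplacian (laplacian u)) x r) (at r)" for r
    using weighted_mean_derivative[OF CL, of 2 x r] by (simp add: S_def numeral_eq_Suc)
  have dT: "(T has_real_derivative r / 4 * S r) (at r)" for r
    using weighted_mean_derivative[OF C2, of 1 x r] by (simp add: S_def T_def numeral_eq_Suc)
  have "weighted_mean 3 (laplacian (laplacian u)) x r \<ge> 0" for r
    unfolding weighted_mean_def
    by (cases "(\<lambda>y. laplacian (laplacian u) (x + r *\<^sub>R y) * weight 3 y) integrable_on big_cube")
      (auto intro!: integral_nonneg mult_nonneg_nonneg bi weight_nonneg simp: not_integrable_integral)
  then have "S 0 \<le> S r" if "r \<ge> 0" for r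
    by (intro DERIV_nonneg_imp_nondecreasing[OF that]) (use dS in \<open>fastforce\<close>)
  moreover have "S 0 = c"
    by (simp add: S_def weighted_mean_def c_def)
  ultimately have S: "c \<le> S r" if "r \<ge> 0" for r
    using that by auto
  \<comment> \<open>Integration of T' = r S/4 >= c r/4.\<close>
  have T: "T 0 \<le> T r - c * r\<^sup>2 / 8" if "r \<ge> 0" for r
  proof -
    have "T 0 - c * 0\<^sup>2 / 8 \<le> T r - c * r\<^sup>2 / 8"
    proof (rule DERIV_nonneg_imp_nondecreasing[OF that])
      fix s assume s: "0 \<le> s" "s \<le> r"
      have "((\<lambda>r. T r - c * r\<^sup>2 / 8) has_real_derivative s / 4 * S s - c * s / 4) (at s)"
        by (auto intro!: derivative_eq_intros dT)
      moreover have "s / 4 * S s - c * s / 4 \<ge> 0"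
        using S[OF s(1)] s(1) mult_left_mono[of c "S s" "s / 4"] by (simp add: mult.commute)
      ultimately show "\<exists>y. ((\<lambda>r. T r - c * r\<^sup>2 / 8) has_real_derivative y) (at s) \<and> y \<ge> 0"
        by blast
    qed
    then show ?thesis by simp
  qed
  have intT: "(\<lambda>y. u (x + r *\<^sub>R y) * weight 1 y) integrable_on big_cube" for r
    unfolding big_cube_def
    by (intro integrable_continuous continuous_intros continuous_on_weight continuous_on_compose2[OF cu]) simp
  have T_le: "T r \<le> B * integral big_cube (weight 1 :: real^'n \<Rightarrow> real)" for r
  proof -
    have "(\<lambda>y::real^'n. B * weight 1 y) integrable_on big_cube"
      unfolding big_cube_def by (intro integrable_continuous continuous_intros continuous_on_weight)
    then have "T r \<le> integral big_cube (\<lambda>y::real^'n. B * weight 1 y)"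
      unfolding T_def weighted_mean_def
      by (intro integral_le intT mult_right_mono u weight_nonneg)
    then show ?thesis by simp
  qed
  have "T 0 \<ge> 0"
    unfolding T_def weighted_mean_def
    by (intro integral_nonneg intT mult_nonneg_nonneg weight_nonneg) (use u in \<open>auto intro: less_imp_le\<close>)
  then have bound: "c * r\<^sup>2 / 8 \<le> B * integral big_cube (weight 1 :: real^'n \<Rightarrow> real)" if "r \<ge> 0" for r
    using T[OF that] T_le[of r] by linarith
  define M where "M = B * integral big_cube (weight 1 :: real^'n \<Rightarrow> real)"
  have "M \<ge> 0"
    using bound[of 0] by (simp add: M_def)
  \<comment> \<open>The radius is chosen so that c r^2/8 = M + 1, one more than the bound
    allows.\<close>
  then have "c * (8 * (M + 1) / c) / 8 \<le> M"
    using bound[of "sqrt (8 * (M + 1) / c)"] c by (simp add: M_def)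
  then show False
    using c by simp
qed

section \<open>The sequences and the limit\<close>

text \<open>The recursion is the solution formula, with the larger root, of the quadratic equation
  stating that the E^2 coefficient vanishes; the radicand is its discriminant.\<close>

lemma alpha_step_root:
  fixes N \<alpha>' :: real
  assumes N: "N > 4" and \<alpha>': "0 \<le> \<alpha>'"
  defines "\<alpha> \<equiv> (4 * (\<alpha>' + 1) - N + sqrt (N * (16 * \<alpha>'\<^sup>2 + 24 * \<alpha>' + N + 8))) / (4 * (N - 1))"
  shows "0 \<le> \<alpha>" "2 * N * \<alpha>\<^sup>2 + N * \<alpha> = 2 * (\<alpha> + \<alpha>' + 1)\<^sup>2"
proof -
  define D where "D = N * (16 * \<alpha>'\<^sup>2 + 24 * \<alpha>' + N + 8)"
  define s where "s = sqrt D"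
  have D: "N\<^sup>2 \<le> D"
    using N \<alpha>' by (simp add: D_def power2_eq_square)
  then have s2: "s\<^sup>2 = D"
    using order_trans[OF zero_le_power2[of N]] by (simp add: s_def)
  have sN: "N \<le> s"
    using D by (simp add: s_def real_le_rsqrt)
  have \<alpha>: "4 * (N - 1) * \<alpha> = 4 * (\<alpha>' + 1) - N + s"
    using N by (simp add: \<alpha>_def s_def D_def)
  show "0 \<le> \<alpha>"
    using N \<alpha>' sN unfolding \<alpha>_def D_def[symmetric] s_def[symmetric] by simp
  have "s = 4 * (N - 1) * \<alpha> - 4 * (\<alpha>' + 1) + N"
    using \<alpha> by simp
  then have "D = (4 * (N - 1) * \<alpha> - 4 * (\<alpha>' + 1) + N)\<^sup>2"
    using s2 by simp
  then have "8 * (N - 1) * (2 * N * \<alpha>\<^sup>2 + N * \<alpha> - 2 * (\<alpha> + \<alpha>' + 1)\<^sup>2) = 0"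
    unfolding D_def by (simp add: power2_eq_square algebra_simps)
  then show "2 * N * \<alpha>\<^sup>2 + N * \<alpha> = 2 * (\<alpha> + \<alpha>' + 1)\<^sup>2"
    using N by simp
qed

text \<open>The equation of the recursion with both constants equal to \<open>l\<close>. Its two
  roots are the possible limits.\<close>

lemma alpha_fixed_point:
  fixes N l :: real
  assumes "N > 4"
  shows "2 * N * l\<^sup>2 + N * l - 2 * (2 * l + 1)\<^sup>2 = (2 * N - 8) * (l - 2 / (N - 4)) * (l + 1 / 2)"
proof -
  have "(2 * N - 8) * (l - 2 / (N - 4)) = (2 * N - 8) * l - 4"
    using assms by (simp add: field_simps)
  then have "(2 * N - 8) * (l - 2 / (N - 4)) * (l + 1 / 2) = ((2 * N - 8) * l - 4) * (l + 1 / 2)"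
    by (rule arg_cong)
  also have "\<dots> = 2 * N * l\<^sup>2 + N * l - 2 * (2 * l + 1)\<^sup>2"
    by (simp add: power2_eq_square algebra_simps)
  finally show ?thesis ..
qed

text \<open>For fixed \<alpha>' the polynomial 2 N x^2 + N x - 2 (x + \<alpha>' + 1)^2 is
  nonpositive at x = \<alpha>', nonnegative at x = 2/(N - 4), and zero at x = \<alpha>. In the
  factorisation \<open>diff\<close> the second factor is positive at both points, so these signs
  order the three numbers.\<close>

lemma alpha_step_bounds:
  fixes N \<alpha> \<alpha>' :: real
  assumes N: "N > 4" and \<alpha>': "0 \<le> \<alpha>'" "\<alpha>' \<le> 2 / (N - 4)" and \<alpha>: "0 \<le> \<alpha>"
    and root: "2 * N * \<alpha>\<^sup>2 + N * \<alpha> = 2 * (\<alpha> + \<alpha>' + 1)\<^sup>2"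
  shows "\<alpha>' \<le> \<alpha>" "\<alpha> \<le> 2 / (N - 4)"
proof -
  let ?c = "2 / (N - 4)"
  have diff: "(2 * N * \<alpha>\<^sup>2 + N * \<alpha> - 2 * (\<alpha> + \<alpha>' + 1)\<^sup>2) - (2 * N * x\<^sup>2 + N * x - 2 * (x + \<alpha>' + 1)\<^sup>2)
      = (\<alpha> - x) * ((2 * N - 2) * (\<alpha> + x) + (N - 4) - 4 * \<alpha>')" for x
    by (simp add: power2_eq_square algebra_simps)
  show "\<alpha>' \<le> \<alpha>"
  proof (rule ccontr)
    assume lt: "\<not> \<alpha>' \<le> \<alpha>"
    have "(2 * N - 8) * (\<alpha>' - ?c) * (\<alpha>' + 1 / 2) \<le> 0"
      using N \<alpha>' by (intro mult_nonpos_nonneg mult_nonneg_nonpos) auto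
    then have "2 * N * \<alpha>'\<^sup>2 + N * \<alpha>' - 2 * (\<alpha>' + \<alpha>' + 1)\<^sup>2 \<le> 0"
      using alpha_fixed_point[OF N, of \<alpha>'] by simp
    then have "0 \<le> (\<alpha> - \<alpha>') * ((2 * N - 2) * (\<alpha> + \<alpha>') + (N - 4) - 4 * \<alpha>')"
      using diff[of \<alpha>'] root by linarith
    moreover have "0 < (2 * N - 2) * (\<alpha> + \<alpha>') + (N - 4) - 4 * \<alpha>'"
    proof -
      have "4 * \<alpha>' \<le> (2 * N - 2) * (\<alpha> + \<alpha>')"
        using N \<alpha>' \<alpha> by (intro mult_mono) auto
      then show ?thesis using N by simp
    qed
    ultimately show False
      using lt by (simp add: zero_le_mult_iff)
  qed
  show "\<alpha> \<le> ?c"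
  proof (rule ccontr)
    assume lt: "\<not> \<alpha> \<le> ?c"
    have "(?c + \<alpha>' + 1)\<^sup>2 \<le> (2 * ?c + 1)\<^sup>2"
      using \<alpha>' N by (intro power_mono) auto
    then have "0 \<le> 2 * N * ?c\<^sup>2 + N * ?c - 2 * (?c + \<alpha>' + 1)\<^sup>2"
      using alpha_fixed_point[OF N, of ?c] by simp
    then have "(\<alpha> - ?c) * ((2 * N - 2) * (\<alpha> + ?c) + (N - 4) - 4 * \<alpha>') \<le> 0"
      using diff[of ?c] root by linarith
    moreover have "0 < (2 * N - 2) * (\<alpha> + ?c) + (N - 4) - 4 * \<alpha>'"
    proof -
      have "4 * \<alpha>' \<le> (2 * N - 2) * (\<alpha> + ?c)"
        using N \<alpha>' \<alpha> by (intro mult_mono) auto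
      then show ?thesis using N by simp
    qed
    ultimately show False
      using lt by (simp add: mult_le_0_iff)
  qed
qed

lemma alpha_seq_bounds:
  assumes "n \<ge> 5"
  shows "0 \<le> alpha_seq n k \<and> alpha_seq n k \<le> 2 / (real n - 4)"
proof (induction k)
  case (Suc k)
  have "real n > 4" using assms by simp
  then show ?case
    using alpha_step_root[of "real n" "alpha_seq n k"] alpha_step_bounds(2)[of "real n" "alpha_seq n k"] Suc.IH
    by simp
qed (use assms in simp)

lemma alpha_seq_step:
  assumes "n \<ge> 5"
  shows "2 * real n * (alpha_seq n (Suc k))\<^sup>2 + real n * alpha_seq n (Suc k)
      = 2 * (alpha_seq n (Suc k) + alpha_seq n k + 1)\<^sup>2"
    and "alpha_seq n k \<le> alpha_seq n (Suc k)"
proof -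
  have N: "real n > 4" using assms by simp
  have b: "0 \<le> alpha_seq n k" "alpha_seq n k \<le> 2 / (real n - 4)"
    using alpha_seq_bounds[OF assms] by auto
  show *: "2 * real n * (alpha_seq n (Suc k))\<^sup>2 + real n * alpha_seq n (Suc k)
      = 2 * (alpha_seq n (Suc k) + alpha_seq n k + 1)\<^sup>2"
    using alpha_step_root(2)[OF N b(1)] by simp
  show "alpha_seq n k \<le> alpha_seq n (Suc k)"
    by (rule alpha_step_bounds(1)[OF N b _ *]) (use alpha_seq_bounds[OF assms] in blast)
qed

text \<open>Monotone and bounded, hence convergent to a fixed point; nonnegativity excludes the root
  -1/2.\<close>

lemma alpha_seq_limit:
  assumes "n \<ge> 5"
  shows "alpha_seq n \<longlonglongrightarrow> 2 / (real n - 4)"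
proof -
  let ?a = "alpha_seq n"
  have N: "real n > 4" using assms by simp
  have "incseq ?a"
    by (rule incseq_SucI) (rule alpha_seq_step(2)[OF assms])
  then obtain l where l: "?a \<longlonglongrightarrow> l" "\<And>k. ?a k \<le> l"
    using incseq_convergent[of ?a] alpha_seq_bounds[OF assms] by metis
  have "0 \<le> l"
    using l(2)[of 0] by simp
  have lS: "(\<lambda>k. ?a (Suc k)) \<longlonglongrightarrow> l"
    using l(1) by (rule LIMSEQ_Suc)
  have "(\<lambda>k. 2 * real n * (?a (Suc k))\<^sup>2 + real n * ?a (Suc k)) \<longlonglongrightarrow> 2 * real n * l\<^sup>2 + real n * l"
    by (intro tendsto_intros lS)
  moreover have "(\<lambda>k. 2 * (?a (Suc k) + ?a k + 1)\<^sup>2) \<longlonglongrightarrow> 2 * (l + l + 1)\<^sup>2"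
    by (intro tendsto_intros lS l)
  ultimately have "2 * real n * l\<^sup>2 + real n * l = 2 * (l + l + 1)\<^sup>2"
    unfolding alpha_seq_step(1)[OF assms] by (rule LIMSEQ_unique)
  then have "(2 * real n - 8) * (l - 2 / (real n - 4)) * (l + 1 / 2) = 0"
    using alpha_fixed_point[OF N, of l] by simp
  then have "l = 2 / (real n - 4)"
    using N \<open>0 \<le> l\<close> by auto
  with l(1) show ?thesis by simp
qed

lemma beta_seq_step:
  assumes "n \<ge> 5" "p > 0"
  shows "(p + 1) / 2 * (beta_seq n p (Suc k))\<^sup>2 = 1 + 2 / real n * alpha_seq n k * (beta_seq n p k)\<^sup>2"
proof -
  have "0 \<le> alpha_seq n k * (beta_seq n p k)\<^sup>2"
    using alpha_seq_bounds[OF assms(1)] by simp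
  then have "0 \<le> 2 / (p + 1) + 4 / ((p + 1) * real n) * alpha_seq n k * (beta_seq n p k)\<^sup>2"
    using assms by (simp add: mult.assoc)
  then have "(beta_seq n p (Suc k))\<^sup>2 = 2 / (p + 1) + 4 / ((p + 1) * real n) * alpha_seq n k * (beta_seq n p k)\<^sup>2"
    by simp
  also have "\<dots> = 2 / (p + 1) * (1 + 2 / real n * alpha_seq n k * (beta_seq n p k)\<^sup>2)"
    by (simp add: distrib_left)
  finally have \<beta>: "(beta_seq n p (Suc k))\<^sup>2 = 2 / (p + 1) * (1 + 2 / real n * alpha_seq n k * (beta_seq n p k)\<^sup>2)" .
  have cancel: "r / 2 * (2 / r * Z) = Z" if "r \<noteq> 0" for r Z :: real
    using that by simp
  show ?thesis
    unfolding \<beta> by (rule cancel) (use assms(2) in simp)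
qed

text \<open>A positive lower bound uniform in k, so that the F term survives when k tends to
  infinity.\<close>

lemma beta_seq_ge:
  assumes "n \<ge> 5" "p > 0"
  shows "sqrt (2 / (p + 1)) \<le> beta_seq n p k"
proof (cases k)
  case (Suc j)
  have "0 \<le> alpha_seq n j * (beta_seq n p j)\<^sup>2"
    using alpha_seq_bounds[OF assms(1)] by simp
  then have "0 \<le> 4 / ((p + 1) * real n) * (alpha_seq n j * (beta_seq n p j)\<^sup>2)"
    using assms by simp
  then show ?thesis
    by (simp add: Suc mult.assoc)
qed simp

text \<open>A_k is the discriminant condition with b = a/2, solved for a. The sign of the
  denominator has to be discussed; a negative one would make A_k negative, against 0 <= a.\<close>

lemma A_seq_condition:
  assumes n: "n \<ge> 5" and p: "p > 0" and a: "0 \<le> a" "a \<le> A_seq n p k"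
  shows "0 \<le> I3 n p k"
    and "a / 2 * beta_seq n p (Suc k) * ((p + 1) / 2 - alpha_seq n (Suc k))\<^sup>2
      \<le> (real n - 2 + a / 2) * I3 n p k"
proof -
  let ?I = "I3 n p k"
  let ?X = "beta_seq n p (Suc k) * ((p + 1) / 2 - alpha_seq n (Suc k))\<^sup>2"
  have X: "0 \<le> ?X"
    using beta_seq_ge[OF n p, of "Suc k"] p
    by (intro mult_nonneg_nonneg) (auto intro: order_trans[rotated] simp del: beta_seq.simps)
  have N: "real n > 2" using n by simp
  have a': "a \<le> 2 * (real n - 2) * ?I / (?X - ?I)"
    using a(2) by (simp add: A_seq_def)
  have "0 \<le> ?I \<and> a / 2 * ?X \<le> (real n - 2 + a / 2) * ?I"
  proof (cases "?X - ?I" "0::real" rule: linorder_cases)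
    case less
    then have "2 * (real n - 2) * ?I / (?X - ?I) < 0"
      using X N by (intro divide_pos_neg) auto
    then show ?thesis using a a' by simp
  next
    \<comment> \<open>Division by zero yields 0, so a = 0, and the claims follow from I = X >=
      0.\<close>
    case equal
    then have "a = 0" using a a' by simp
    then show ?thesis using equal X N by simp
  next
    case greater
    then have le: "a * (?X - ?I) \<le> 2 * (real n - 2) * ?I"
      using a' by (simp add: pos_le_divide_eq)
    moreover have "0 \<le> a * (?X - ?I)"
      using a(1) greater by simp
    ultimately have "0 \<le> 2 * (real n - 2) * ?I"
      by linarith
    then have "0 \<le> ?I"
      using N by (simp add: zero_le_mult_iff)
    then show ?thesis
      using le by (simp add: algebra_simps)
  qed
  then show "0 \<le> ?I" "a / 2 * beta_seq n p (Suc k) * ((p + 1) / 2 - alpha_seq n (Suc k))\<^sup>2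
      \<le> (real n - 2 + a / 2) * ?I"
    by (simp_all add: mult.assoc)
qed

section \<open>Induction along the sequences and passage to the limit\<close>

lemma iterated_pointwise_estimate:
  fixes u :: "real ^ 'n::finite \<Rightarrow> real"
  assumes n: "n = CARD('n)" "n \<ge> 5" and a: "a \<ge> 0" and p: "p > (real n + 4 + 2 * a) / (real n - 4)"
    and A: "\<And>k. a \<le> A_seq n p k" and sol: "bounded_positive_solution a p u"
  shows "laplacian u x \<le> - alpha_seq n k * grad_energy u x
    - beta_seq n p k * (norm_pow x (a / 2) * u x powr ((p + 1) / 2))"
proof -
  define q where "q = (p + 1) / 2"
  define b where "b = a / 2"
  have N: "real n > 4" using n by simp
  have p': "(p - 1) * (real n - 4) > 8 + 2 * a"
    using p N by (simp add: field_simps)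
  have "p > 1"
  proof (rule ccontr)
    assume "\<not> p > 1"
    then have "(p - 1) * (real n - 4) \<le> 0"
      using N by (simp add: mult_nonpos_nonneg)
    then show False using p' a by simp
  qed
  then have q: "q \<ge> 1" "2 * q = p + 1" and p0: "p > 0"
    by (auto simp: q_def)
  have C: "C_k 4 u" and pos: "\<And>y. u y > 0" and "bounded (range u)"
    and eq: "\<And>y. laplacian (laplacian u) y = norm_pow y a * u y powr p"
    using sol by (auto simp: bounded_positive_solution_def)
  then obtain B where B: "\<And>y. u y \<le> B"
    using bounded_pos by (metis abs_le_D1 rangeI real_norm_def)
  have eq': "laplacian (laplacian u) y = norm_pow y (2 * b) * u y powr (2 * q - 1)" for y
  proof -
    have "2 * q - 1 = p" "2 * b = a"
      by (simp_all add: q(2) b_def)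
    then show ?thesis
      using eq by simp
  qed
  have L0: "laplacian u y \<le> 0" for y
    by (rule laplacian_nonpos_of_bounded_bilaplacian_nonneg[OF C pos B]) (simp add: eq norm_pow_nonneg)
  have b0: "0 \<le> b" using a by (simp add: b_def)
  have \<beta>0: "0 \<le> beta_seq n p j" for j
    using beta_seq_ge[OF n(2) p0, of j] p0 order_trans[of 0 "sqrt (2 / (p + 1))"] by simp
  note step = pointwise_estimate_step[OF C pos B eq', folded n(1)]
  have "\<forall>x. laplacian u x \<le> - alpha_seq n k * grad_energy u x
    - beta_seq n p k * (norm_pow x b * u x powr q)"
  proof (induction k)
    \<comment> \<open>One application of the step to L <= 0, that is with \<alpha>' = \<beta>' = 0.
      Now I is q (q - 1) times \<beta>_0, and the discriminant condition reduces to b <= (n - 2)(q -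
      1), a consequence of the lower bound for p.\<close>
    case 0
    have "(beta_seq n p 0)\<^sup>2 = 1 / q"
      using p0 by (simp add: q_def)
    then have c2: "q * (beta_seq n p 0)\<^sup>2 \<le> 1 + 2 * 0 / real n * 0\<^sup>2"
      using q by simp
    have "b * q \<le> (real n - 2 + b) * (q - 1)"
    proof -
      have "(real n - 4) * (p - 1) \<le> (real n - 2) * (p - 1)"
        using \<open>p > 1\<close> by (intro mult_right_mono) auto
      then have "2 * b \<le> (real n - 2) * (2 * (q - 1))"
        using p' a q(2) by (simp add: b_def mult.commute)
      then show ?thesis by (simp add: algebra_simps)
    qed
    then have "b * q * (beta_seq n p 0 * q) \<le> (real n - 2 + b) * (q - 1) * (beta_seq n p 0 * q)"
      using \<beta>0[of 0] q by (intro mult_right_mono mult_nonneg_nonneg) auto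
    then have c3: "b * beta_seq n p 0 * (q - 0)\<^sup>2 \<le> (real n - 2 + b) * (q * (q - 1) * beta_seq n p 0)"
      by (simp add: power2_eq_square mult_ac)
    show ?case
    proof (intro allI)
      fix x
      have "laplacian u x \<le> - 0 * grad_energy u x - beta_seq n p 0 * (norm_pow x b * u x powr q)"
        by (rule step[where \<alpha>' = 0 and \<beta>' = 0, OF _ _ _ _ \<beta>0 b0 q(1) _ _ c2 _ _ c3])
          (use L0 n \<beta>0[of 0] q in auto)
      then show "laplacian u x \<le> - alpha_seq n 0 * grad_energy u x
          - beta_seq n p 0 * (norm_pow x b * u x powr q)"
        by simp
    qed
  next
    case (Suc k)
    let ?\<alpha> = "alpha_seq n (Suc k)" and ?\<alpha>' = "alpha_seq n k"
    let ?\<beta> = "beta_seq n p (Suc k)" and ?\<beta>' = "beta_seq n p k"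
    have \<alpha>: "0 \<le> ?\<alpha>" "0 \<le> ?\<alpha>'" "?\<alpha>' \<le> ?\<alpha>"
      using alpha_seq_bounds[OF n(2)] alpha_seq_step(2)[OF n(2)] by blast+
    have "2 / real n * (1 + ?\<alpha> + ?\<alpha>')\<^sup>2 = (2 * (?\<alpha> + ?\<alpha>' + 1)\<^sup>2) / real n"
      by (simp add: add_ac)
    also have "\<dots> = 2 * ?\<alpha>\<^sup>2 + ?\<alpha>"
      unfolding alpha_seq_step(1)[OF n(2), symmetric] using N by (simp add: field_simps del: alpha_seq.simps)
    finally have c1: "0 \<le> ?\<alpha> * (2 / real n * (1 + ?\<alpha> + ?\<alpha>')\<^sup>2 - 2 * ?\<alpha>\<^sup>2 - ?\<alpha>)"
      by (simp del: alpha_seq.simps)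
    \<comment> \<open>The recursion for \<beta> contains the old \<alpha>', the step allows the new
      \<alpha>; monotonicity of the first sequence closes the gap.\<close>
    have "?\<alpha>' * ?\<beta>'\<^sup>2 \<le> ?\<alpha> * ?\<beta>'\<^sup>2"
      using \<alpha>(3) by (rule mult_right_mono) simp
    then have "2 / real n * (?\<alpha>' * ?\<beta>'\<^sup>2) \<le> 2 / real n * (?\<alpha> * ?\<beta>'\<^sup>2)"
      by (rule mult_left_mono) simp
    moreover have "q * ?\<beta>\<^sup>2 = 1 + 2 / real n * (?\<alpha>' * ?\<beta>'\<^sup>2)"
      using beta_seq_step[OF n(2) p0, of k] unfolding q_def by (simp only: mult.assoc)
    ultimately have "q * ?\<beta>\<^sup>2 \<le> 1 + 2 / real n * (?\<alpha> * ?\<beta>'\<^sup>2)"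
      by linarith
    then have c2: "q * ?\<beta>\<^sup>2 \<le> 1 + 2 * ?\<alpha> / real n * ?\<beta>'\<^sup>2"
      by (simp only: mult.assoc times_divide_eq_left)
    have I: "I3 n p k = 4 / real n * ?\<alpha> * ?\<beta>' * (?\<alpha> + ?\<alpha>' + 1) + ?\<beta> * ?\<alpha> - 2 * q * ?\<beta> * ?\<alpha>
        + q * (q - 1 - ?\<alpha>) * ?\<beta>"
      unfolding I3_def q(2) by (simp add: q_def diff_divide_distrib add_divide_distrib del: alpha_seq.simps beta_seq.simps)
    show ?case
      using Suc.IH \<alpha> c1 c2 n
      by (intro allI step[where \<alpha>' = ?\<alpha>' and \<beta>' = ?\<beta>', OF _ \<alpha>(1,2) \<beta>0 \<beta>0 b0 q(1) _ c1 c2 I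
            A_seq_condition(1)[OF n(2) p0 a A] A_seq_condition(2)[OF n(2) p0 a A, folded q_def b_def]])
        auto
  qed
  then show ?thesis
    by (simp add: q_def b_def)
qed

lemma limiting_pointwise_estimate:
  fixes u :: "real ^ 'n::finite \<Rightarrow> real"
  assumes n: "n = CARD('n)" "n \<ge> 5" and a: "a \<ge> 0" and p: "p > (real n + 4 + 2 * a) / (real n - 4)" "p > 0"
    and A: "\<And>k. a \<le> A_seq n p k" and sol: "bounded_positive_solution a p u"
  shows "laplacian u x \<le> - (2 / (real n - 4)) * grad_energy u x
    - sqrt (2 / (p + 1)) * (norm_pow x (a / 2) * u x powr ((p + 1) / 2))"
proof (rule LIMSEQ_le_const)
  let ?G = "norm_pow x (a / 2) * u x powr ((p + 1) / 2)"
  show "(\<lambda>k. - alpha_seq n k * grad_energy u x - sqrt (2 / (p + 1)) * ?G)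
      \<longlonglongrightarrow> - (2 / (real n - 4)) * grad_energy u x - sqrt (2 / (p + 1)) * ?G"
    by (intro tendsto_intros alpha_seq_limit n)
  have "laplacian u x \<le> - alpha_seq n k * grad_energy u x - sqrt (2 / (p + 1)) * ?G" for k
  proof -
    have "sqrt (2 / (p + 1)) * ?G \<le> beta_seq n p k * ?G"
      using beta_seq_ge[OF n(2) p(2)] by (intro mult_right_mono) (auto simp: norm_pow_nonneg)
    then show ?thesis
      using iterated_pointwise_estimate[OF n a p(1) A sol, of x k] by linarith
  qed
  then show "\<exists>N. \<forall>k\<ge>N. laplacian u x \<le> - alpha_seq n k * grad_energy u x - sqrt (2 / (p + 1)) * ?G"
    by blast
qed

text \<open>Taking \<beta> = 0 and both constants equal to the fixed point c makes the E^2
  coefficient zero, so Lap z >= (2c/u) grad u . grad z everywhere. A zero of \<open>z\<close> at the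
  origin, with negative values elsewhere, contradicts the maximum principle for this
  operator.\<close>

lemma strict_at_origin:
  fixes u :: "real ^ 'n::finite \<Rightarrow> real"
  defines "c \<equiv> 2 / (real CARD('n) - 4)"
  defines "z \<equiv> \<lambda>x. laplacian u x + c * grad_energy u x"
  assumes n: "CARD('n) \<ge> 5" and C: "C_k 4 u" and pos: "\<And>x. u x > 0"
    and eq: "\<And>x. laplacian (laplacian u) x = norm_pow x a * u x powr p"
    and z: "\<And>x. z x \<le> 0" "\<And>x. x \<noteq> 0 \<Longrightarrow> z x < 0"
  shows "z 0 < 0"
proof (rule ccontr)
  assume "\<not> z 0 < 0"
  then have z0: "z 0 = 0" using z(1)[of 0] by simp
  have N: "real CARD('n) > 4" using n by simp
  have c0: "c \<ge> 0" using N by (simp add: c_def)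
  have C4: "C_k (Suc (Suc (Suc (Suc 0)))) u"
    using C by (simp add: numeral_eq_Suc)
  then have C2: "C_k (Suc (Suc 0)) u"
    using C_k_SucD by blast
  have C2': "C_k 2 u"
    using C2 by (simp add: numeral_eq_Suc)
  have u0: "u y \<noteq> 0" for y
    using pos[of y] by simp
  have cu: "continuous_on S u" for S
    using C_k_continuous[OF C2] continuous_on_subset by blast
  have cg: "continuous_on S (grad u)" for S
  proof -
    have "continuous_on UNIV (partial_deriv i u)" for i
      using C_k_continuous[of "Suc 0" "partial_deriv i u"] C2 by simp
    then have "continuous_on S (partial_deriv i u)" for i
      using continuous_on_subset by blast
    then show ?thesis
      unfolding grad_def[abs_def] by (rule continuous_on_vec_lambda)
  qed
  have cz: "continuous_on S z" for S
    unfolding z_def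
    by (intro continuous_on_add continuous_on_mult continuous_on_const
        continuous_on_grad_energy[OF C2' pos]
        continuous_on_subset[OF C_k_continuous[OF C_k_laplacian[OF C4]] subset_UNIV])
  have fixed: "2 / real CARD('n) * (1 + c + c)\<^sup>2 - 2 * c\<^sup>2 - c = 0"
  proof -
    have "2 * real CARD('n) * c\<^sup>2 + real CARD('n) * c - 2 * (2 * c + 1)\<^sup>2 = 0"
      using alpha_fixed_point[OF N, of c] by (simp add: c_def)
    then have "(2 * (2 * c + 1)\<^sup>2) / real CARD('n) = (2 * real CARD('n) * c\<^sup>2 + real CARD('n) * c) / real CARD('n)"
      by simp
    also have "\<dots> = 2 * c\<^sup>2 + c"
      using N by (simp add: add_divide_distrib)
    finally show ?thesis by (simp add: add_ac)
  qed
  have jet: "\<exists>G M. has_jet2 z x G M \<and> 2 * c / u x * (grad u x \<bullet> G) \<le> M" for x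
  proof -
    obtain f where Jf: "has_jet2 f x ((a / 2 * norm_pow x (a / 2) / (x \<bullet> x)) *\<^sub>R x)
        (a / 2 * (real CARD('n) - 2 + a / 2) * norm_pow x (a / 2) / (x \<bullet> x))"
      and fx: "f x = norm_pow x (a / 2)"
      using norm_pow_minorant[of x "a / 2"] by blast
    have half: "2 * ((p + 1) / 2) - 1 = p"
      by (simp add: field_simps)
    obtain G M where J: "has_jet2 (\<lambda>y. laplacian u y + c * grad_energy u y + 0 * (f y * u y powr ((p + 1) / 2))) x G M"
      "2 * c / u x * (grad u x \<bullet> G)
        + (- c * grad_energy u x + (p + 1) / 2 * 0 * (f x * u x powr ((p + 1) / 2))) / u x
          * (laplacian u x + c * grad_energy u x + 0 * (f x * u x powr ((p + 1) / 2))) \<le> M"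
      by (rule differential_inequality[OF C pos[of x] Jf, where \<alpha> = c and \<alpha>' = c and \<beta>' = 0 and \<beta> = 0
            and q = "(p + 1) / 2"])
        (use half fx norm_pow_nonneg[of x] eq[of x] norm_pow_double[of x "a / 2"] c0 fixed z(1)[of x]
          in \<open>auto simp: z_def\<close>)
    have "(- c * grad_energy u x) / u x * z x \<ge> 0"
      using c0 pos[of x] z(1)[of x] by (intro mult_nonpos_nonpos divide_nonpos_pos) (auto simp: grad_energy_def)
    then show ?thesis
      using J by (intro exI[of _ G] exI[of _ M]) (simp add: z_def[abs_def])
  qed
  define V where "V x = 2 * c / u x * norm (grad u x)" for x
  have "continuous_on (cball 0 1) V"
    unfolding V_def[abs_def]
    by (intro continuous_on_mult continuous_on_divide continuous_on_const continuous_on_norm cg cu ballI u0)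
  then obtain y where y: "\<forall>x\<in>cball 0 1. V x \<le> V y"
    using continuous_attains_sup[OF compact_cball, of 0 1 V] by auto
  define K where "K = V y"
  have K: "K \<ge> 0" "\<And>x. norm x \<le> 1 \<Longrightarrow> V x \<le> K"
    using y c0 pos[of y] by (auto simp: K_def V_def)
  \<comment> \<open>\<open>K\<close> bounds the drift on the unit ball. For this radius the drift
    acting on |x|^2 is weaker than its Laplacian, so adding a multiple of |x|^2 makes the inequality
    strict.\<close>
  define \<rho> where "\<rho> = 1 / (K + 1)"
  have \<rho>: "0 < \<rho>" "\<rho> \<le> 1" "K * \<rho> < 1"
    using K(1) by (auto simp: \<rho>_def)
  have "sphere 0 \<rho> \<noteq> ({} :: (real^'n) set)"
    using \<rho> by simp
  then obtain x0 where x0: "x0 \<in> sphere 0 \<rho>" "\<And>x. x \<in> sphere 0 \<rho> \<Longrightarrow> z x \<le> z x0"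
    using continuous_attains_sup[OF compact_sphere _ cz, of 0 \<rho>] by blast
  have "z x0 < 0"
    using x0(1) \<rho> by (intro z) auto
  \<comment> \<open>Small enough that h = z + e |x|^2 stays negative on the sphere, while h 0 = 0;
    the maximum of \<open>h\<close> is thus interior.\<close>
  define e where "e = - z x0 / (2 * \<rho>\<^sup>2)"
  have e: "e > 0" "e * \<rho>\<^sup>2 < - z x0"
    using \<open>z x0 < 0\<close> \<rho> by (auto simp: e_def divide_neg_pos)
  define h where "h x = z x + e * (x \<bullet> x)" for x
  have "continuous_on (cball 0 \<rho>) h"
    unfolding h_def[abs_def] by (intro continuous_intros cz)
  then obtain x1 where x1: "x1 \<in> cball 0 \<rho>" "\<And>x. x \<in> cball 0 \<rho> \<Longrightarrow> h x \<le> h x1"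
    using continuous_attains_sup[OF compact_cball, of 0 \<rho> h] \<rho> by auto
  have "h 0 = 0"
    by (simp add: h_def z0)
  then have "h x1 \<ge> 0"
    using x1(2)[of 0] \<rho> by simp
  have x1_lt: "norm x1 < \<rho>"
  proof (rule ccontr)
    assume "\<not> norm x1 < \<rho>"
    then have nx: "norm x1 = \<rho>" using x1(1) by simp
    then have "z x1 \<le> z x0"
      using x0(2)[of x1] by simp
    then have "h x1 < 0"
      using e nx by (simp add: h_def dot_square_norm)
    then show False using \<open>h x1 \<ge> 0\<close> by simp
  qed
  obtain G M where GM: "has_jet2 z x1 G M" "2 * c / u x1 * (grad u x1 \<bullet> G) \<le> M"
    using jet by blast
  have J: "has_jet2 h x1 (G + e *\<^sub>R 2 *\<^sub>R x1) (M + e * (2 * real CARD('n)))"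
    unfolding h_def[abs_def] by (intro has_jet2_add has_jet2_scale has_jet2_inner_self GM(1))
  have ev: "\<forall>\<^sub>F x in nhds x1. h x \<le> h x1"
  proof -
    have "\<forall>\<^sub>F x in nhds x1. x \<in> ball 0 \<rho>"
      using x1_lt by (intro eventually_nhds_in_open) auto
    then show ?thesis
      by eventually_elim (use x1(2) in auto)
  qed
  have G: "G = - (2 * e) *\<^sub>R x1"
    using has_jet2_local_max(1)[OF J ev] by (simp add: add_eq_0_iff mult.commute)
  have M: "M \<le> - (2 * e * real CARD('n))"
    using has_jet2_local_max(2)[OF J ev] by simp
  have "2 * c / u x1 * (grad u x1 \<bullet> x1) \<le> 2 * c / u x1 * (norm (grad u x1) * norm x1)"
    using c0 pos[of x1] by (intro mult_left_mono norm_cauchy_schwarz) auto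
  also have "\<dots> = V x1 * norm x1"
    by (simp add: V_def)
  also have "\<dots> \<le> K * \<rho>"
    using K x1_lt \<rho> by (intro mult_mono) auto
  finally have lt: "2 * c / u x1 * (grad u x1 \<bullet> x1) < 1"
    using \<rho> by simp
  have "2 * c / u x1 * (grad u x1 \<bullet> G) = - (2 * e) * (2 * c / u x1 * (grad u x1 \<bullet> x1))"
    unfolding G by simp
  then have "(2 * e) * real CARD('n) \<le> (2 * e) * (2 * c / u x1 * (grad u x1 \<bullet> x1))"
    using GM(2) M by simp
  then have "real CARD('n) \<le> 2 * c / u x1 * (grad u x1 \<bullet> x1)"
    using e by (simp only: mult_le_cancel_left_pos)
  then show False
    using lt N by simp
qed

text \<open>A jet of u^m would not determine its \<open>laplacian\<close>, which is defined by
  Frechet derivatives. Differentiability of u^m and of its first partial derivatives is therefore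
  established along the way.\<close>

lemma laplacian_powr:
  fixes u :: "real ^ 'n::finite \<Rightarrow> real"
  assumes C: "C_k 2 u" and pos: "\<And>x. u x > 0"
  shows "laplacian (\<lambda>y. u y powr m) x = m * u x powr (m - 1) * (laplacian u x + (m - 1) * grad_energy u x)"
proof -
  have C2: "C_k (Suc (Suc 0)) u"
    using C by (simp add: numeral_eq_Suc)
  have d: "u differentiable at y" "partial_deriv i u differentiable at y" for y i
    using C2 by simp_all
  have dp: "(\<lambda>y. u y powr r) differentiable at y" for r y
  proof -
    have "(\<lambda>s. s powr r) differentiable at (u y)"
      using has_real_derivative_powr[OF pos[of y], of r] real_differentiable_def by blast
    then show ?thesis
      using differentiable_chain_at[OF d(1)] by (simp add: o_def)
  qed
  have line: "((\<lambda>t. u (y + t *\<^sub>R axis i 1) powr r) has_real_derivative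
      r * u y powr (r - 1) * partial_deriv i u y) (at 0)" for r y i
  proof -
    have "((\<lambda>t. u (y + t *\<^sub>R axis i 1)) has_real_derivative partial_deriv i u y) (at 0)"
      using partial_deriv_has_derivative[of u y 0 i] d(1) by simp
    from DERIV_chain2[OF _ this, of "\<lambda>s. s powr r" "r * u y powr (r - 1)"]
    show ?thesis
      using has_real_derivative_powr[OF pos[of y], of r] by simp
  qed
  have p1: "partial_deriv i (\<lambda>y. u y powr m) = (\<lambda>y. m * u y powr (m - 1) * partial_deriv i u y)" for i
    by (rule ext, rule partial_deriv_eq_line[OF dp line])
  have p2: "partial_deriv i (\<lambda>y. m * u y powr (m - 1) * partial_deriv i u y) x
      = m * ((m - 1) * u x powr (m - 2) * partial_deriv i u x * partial_deriv i u x
        + u x powr (m - 1) * partial_deriv i (partial_deriv i u) x)" for i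
  proof (rule partial_deriv_eq_line)
    show "(\<lambda>y. m * u y powr (m - 1) * partial_deriv i u y) differentiable at x"
      by (intro differentiable_mult differentiable_const dp d)
    have "((\<lambda>t. partial_deriv i u (x + t *\<^sub>R axis i 1)) has_real_derivative
        partial_deriv i (partial_deriv i u) x) (at 0)"
      using partial_deriv_has_derivative[of "partial_deriv i u" x 0 i] d(2) by simp
    from DERIV_cmult[OF DERIV_mult[OF line[of x i "m - 1"] this], of m]
    show "((\<lambda>t. m * u (x + t *\<^sub>R axis i 1) powr (m - 1) * partial_deriv i u (x + t *\<^sub>R axis i 1))
        has_real_derivative m * ((m - 1) * u x powr (m - 2) * partial_deriv i u x * partial_deriv i u x
        + u x powr (m - 1) * partial_deriv i (partial_deriv i u) x)) (at 0)"
      by (simp add: algebra_simps)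
  qed
  have g: "grad u x \<bullet> grad u x = (\<Sum>i\<in>UNIV. partial_deriv i u x * partial_deriv i u x)"
    by (simp add: grad_def inner_vec_def)
  have "laplacian (\<lambda>y. u y powr m) x
      = m * ((m - 1) * (u x powr (m - 2) * (grad u x \<bullet> grad u x)) + u x powr (m - 1) * laplacian u x)"
    unfolding laplacian_def p1 p2 g
    by (simp add: sum.distrib sum_distrib_left mult.assoc distrib_left)
  also have "u x powr (m - 2) * (grad u x \<bullet> grad u x) = u x powr (m - 1) * grad_energy u x"
    using pos[of x] by (simp add: grad_energy_def powr_diff power2_eq_square)
  finally have "laplacian (\<lambda>y. u y powr m) x
      = m * ((m - 1) * (u x powr (m - 1) * grad_energy u x) + u x powr (m - 1) * laplacian u x)" .
  then show ?thesis
    by (simp add: algebra_simps)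
qed

theorem mainTheorem2:
  fixes n :: nat and a p :: real and u :: "real ^ 'n::finite \<Rightarrow> real"
  assumes "n = CARD('n)" and "n \<ge> 5"
    and "a \<ge> 0"
    and "p > (real n + 4 + 2 * a) / (real n - 4)"
    and "ereal a \<le> (INF k. ereal (A_seq n p k))"
    and "bounded_positive_solution a p u"
  shows "\<forall>x. conformal_scalar_curvature u x > 0"
proof
  fix x
  define c where "c = 2 / (real n - 4)"
  have N: "real n > 4" using assms by simp
  have p0: "p > 0"
  proof -
    have "0 \<le> (real n + 4 + 2 * a) / (real n - 4)"
      using assms(3) N by simp
    then show ?thesis using assms(4) by linarith
  qed
  have A: "a \<le> A_seq n p k" for k
    using assms(5) by (simp add: le_INF_iff)
  have C: "C_k 4 u" and pos: "\<And>y. u y > 0"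
    and eq: "\<And>y. laplacian (laplacian u) y = norm_pow y a * u y powr p"
    using assms(6) by (auto simp: bounded_positive_solution_def)
  have est: "laplacian u y + c * grad_energy u y
      \<le> - (sqrt (2 / (p + 1)) * (norm_pow y (a / 2) * u y powr ((p + 1) / 2)))" for y
    using limiting_pointwise_estimate[OF assms(1-4) p0 A assms(6), of y] by (simp add: c_def)
  have nonpos: "laplacian u y + c * grad_energy u y \<le> 0" for y
  proof -
    have "0 \<le> sqrt (2 / (p + 1)) * (norm_pow y (a / 2) * u y powr ((p + 1) / 2))"
      using p0 by (intro mult_nonneg_nonneg) (simp_all add: norm_pow_nonneg)
    then show ?thesis
      using est[of y] by linarith
  qed
  have neg: "laplacian u y + c * grad_energy u y < 0" if "y \<noteq> 0" for y
  proof -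
    have "0 < sqrt (2 / (p + 1)) * (norm_pow y (a / 2) * u y powr ((p + 1) / 2))"
      using that p0 pos[of y] by (intro mult_pos_pos) (auto simp: norm_pow_def)
    then show ?thesis
      using est[of y] by linarith
  qed
  have key: "laplacian u x + c * grad_energy u x < 0"
  proof (cases "x = 0")
    case True
    have "CARD('n) \<ge> 5" using assms by simp
    from strict_at_origin[OF this C pos eq, folded assms(1), folded c_def, OF nonpos neg]
    show ?thesis using True by simp
  qed (rule neg)
  have C2: "C_k 2 u"
    using C_k_SucD[of 3 u] C_k_SucD[of 2 u] C by simp
  \<comment> \<open>The coefficient m - 1 of E in Lap(u^m) is exactly the limit of the constants
    \<alpha>_k.\<close>
  have m: "(real n - 2) / (real n - 4) - 1 = c" "(real n - 2) / (real n - 4) > 0"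
    using N by (simp_all add: c_def field_simps)
  let ?m = "(real n - 2) / (real n - 4)"
  have "conformal_scalar_curvature u x = (4 * (real n - 1) / (real n - 2)) * u x powr (- ((real n + 2) / (real n - 4)))
      * (?m * u x powr c * - (laplacian u x + c * grad_energy u x))"
    unfolding conformal_scalar_curvature_def Let_def assms(1)[symmetric] laplacian_powr[OF C2 pos] m(1)
    by (simp only: mult_minus_left mult_minus_right)
  also have "\<dots> > 0"
    using N pos[of x] key m(2) by (intro mult_pos_pos divide_pos_pos) auto
  finally show "conformal_scalar_curvature u x > 0" .
qed

end
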